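(* Let $f$ be a non-linear metric $f(R)$ gravity model, i.e. $f''(R)\neq 0$. No vacuum exterior spacetime of the form $$ds^2_+=A(t,r)\,dt^2-B(t,r)\,dr^2-r^2d\Omega_{(2)}^2$$ whose Ricci scalar $R^+$ is either a function of $t$ only or a function of $r$ only can be smoothly matched, in the sense of metric $f(R)$ gravity, to the interior of a collapsing uniform-density dust star.
   Context: Conventions: signature $(+,-,-,-)$, $c=1$, $\kappa=8\pi G>0$, Riemann tensor $R^{\rho}{}_{\sigma\mu\nu}=\partial_\nu\Gamma^\rho_{\sigma\mu}+\Gamma^\rho_{\lambda\nu}\Gamma^\lambda_{\sigma\mu}-(\mu\leftrightarrow\nu)$, $R_{\mu\nu}=R^\lambda{}_{\mu\lambda\nu}$, $R=g^{\mu\nu}R_{\mu\nu}$. $f$ is a smooth real function on an interval, $f_R=f'$. The field equations of metric $f(R)$ gravity are $$f_R(R)R_{\mu\nu}-\tfrac12 f(R)g_{\mu\nu}+(\nabla_\mu\nabla_\nu-g_{\mu\nu}\square)f_R(R)=-\kappa T_{\mu\nu}.$$ Interior (collapsing uniform-density dust star): constants $k\in\mathbb R$, $\rho_0>0$, $\chi_*>0$ with $1-k\chi_*^2>0$, and a smooth scale factor $a(\tau)>0$ on $[0,\tau_c)$ with $a(0)=1$, $\dot a(0)=0$ and $\dot a(\tau)<0$ for $0<\tau<\tau_c$ (collapse). The metric, for $0\le \chi\le\chi_*$, is $$ds_-^2=d\tau^2-a^2(\tau)\left(\frac{d\chi^2}{1-k\chi^2}+\chi^2d\Omega_{(2)}^2\right),$$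 and it satisfies the field equations with $T_{\mu\nu}=\rho u_\mu u_\nu$, $u=\partial_\tau$, $\rho(\tau)=\rho_0/a^3(\tau)$. Its Ricci scalar is $R^-=6\left(\frac{\dot a^2+k}{a^2}+\frac{\ddot a}{a}\right)$. Exterior: the metric is required to have smooth $A,B>0$ and to solve the field equations with $T_{\mu\nu}=0$. Matching surface: the timelike hypersurface $\Sigma_*$ given by $\chi=\chi_*$ in interior coordinates and by $t=t_*(\tau)$, $r=r_*(\tau)$ (smooth, $\dot t_*>0$) in exterior coordinates $(t,r,\theta,\varphi)$, with intrinsic coordinates $(\tau,\theta,\varphi)$. Smooth matching: for a quantity $Q$, $[Q]$ is the difference of its values on $\Sigma_*$ computed from the exterior and from the interior. The interior and exterior are smoothly matched in non-linear metric $f(R)$ gravity if all four junction conditions hold along $\Sigma_*$: $[h_{ab}]=0$ (induced metric), $[K_{ab}]=0$ (extrinsic curvature), $[R]=0$, and $[n^\mu\partial_\mu R]=0$, where $n$ is the unit normal to $\Sigma_*$. *)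

theory Defs
  imports "HOL-Analysis.Analysis"
begin

section \<open>Smooth functions\<close>

primrec Ck_on :: "nat \<Rightarrow> 'a::real_normed_vector set \<Rightarrow> ('a \<Rightarrow> real) \<Rightarrow> bool" where
  "Ck_on 0 U h \<longleftrightarrow> continuous_on U h"
| "Ck_on (Suc n) U h \<longleftrightarrow>
     (\<forall>x\<in>U. h differentiable (at x)) \<and>
     (\<forall>v. Ck_on n U (\<lambda>x. frechet_derivative h (at x) v))"

text \<open>On a set that need not be open (such as \<open>[0, \<tau>c)\<close>, or a spacetime region with boundary)
  smoothness means smoothness on some open neighbourhood. The values of the total function \<open>h\<close>
  off the set serve as the extension, so that two-sided derivatives can be used
  at boundary points.\<close>

definition smooth_on :: "'a::real_normed_vector set \<Rightarrow> ('a \<Rightarrow> real) \<Rightarrow> bool" where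
  "smooth_on S h \<longleftrightarrow> (\<exists>U. open U \<and> S \<subseteq> U \<and> (\<forall>n. Ck_on n U h))"

section \<open>Lorentzian geometry in one coordinate chart\<close>

type_synonym metric = "real^4 \<Rightarrow> real^4^4"

definition pd :: "'n::finite \<Rightarrow> (real^'n \<Rightarrow> real) \<Rightarrow> real^'n \<Rightarrow> real" where
  "pd \<mu> h x = deriv (\<lambda>s. h (x + s *\<^sub>R axis \<mu> 1)) 0"

definition ginv :: "metric \<Rightarrow> real^4 \<Rightarrow> real^4^4" where
  "ginv g x = matrix_inv (g x)"

text \<open>\<open>christoffel g \<rho> \<mu> \<nu>\<close> is \<open>\<Gamma>\<^sup>\<rho>\<^sub>\<mu>\<^sub>\<nu>\<close>.\<close>

definition christoffel :: "metric \<Rightarrow> 4 \<Rightarrow> 4 \<Rightarrow> 4 \<Rightarrow> real^4 \<Rightarrow> real" where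
  "christoffel g \<rho> \<mu> \<nu> x =
     (1/2) * (\<Sum>\<alpha>\<in>UNIV. ginv g x $ \<rho> $ \<alpha> *
        (pd \<mu> (\<lambda>z. g z $ \<alpha> $ \<nu>) x + pd \<nu> (\<lambda>z. g z $ \<alpha> $ \<mu>) x - pd \<alpha> (\<lambda>z. g z $ \<mu> $ \<nu>) x))"

text \<open>\<open>riemann g \<rho> \<sigma> \<mu> \<nu>\<close> is \<open>R\<^sup>\<rho>\<^sub>\<sigma>\<^sub>\<mu>\<^sub>\<nu>\<close>, in the convention
  \<open>\<partial>\<^sub>\<nu>\<Gamma>\<^sup>\<rho>\<^sub>\<sigma>\<^sub>\<mu> + \<Gamma>\<^sup>\<rho>\<^sub>\<lambda>\<^sub>\<nu>\<Gamma>\<^sup>\<lambda>\<^sub>\<sigma>\<^sub>\<mu> - (\<mu> \<leftrightarrow> \<nu>)\<close>, which has the opposite sign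
  to that of Misner, Thorne and Wheeler.\<close>

definition riemann :: "metric \<Rightarrow> 4 \<Rightarrow> 4 \<Rightarrow> 4 \<Rightarrow> 4 \<Rightarrow> real^4 \<Rightarrow> real" where
  "riemann g \<rho> \<sigma> \<mu> \<nu> x =
     (pd \<nu> (christoffel g \<rho> \<sigma> \<mu>) x
        + (\<Sum>\<alpha>\<in>UNIV. christoffel g \<rho> \<alpha> \<nu> x * christoffel g \<alpha> \<sigma> \<mu> x))
   - (pd \<mu> (christoffel g \<rho> \<sigma> \<nu>) x
        + (\<Sum>\<alpha>\<in>UNIV. christoffel g \<rho> \<alpha> \<mu> x * christoffel g \<alpha> \<sigma> \<nu> x))"

definition ricci :: "metric \<Rightarrow> 4 \<Rightarrow> 4 \<Rightarrow> real^4 \<Rightarrow> real" where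
  "ricci g \<mu> \<nu> x = (\<Sum>\<alpha>\<in>UNIV. riemann g \<alpha> \<mu> \<alpha> \<nu> x)"

definition ricci_scalar :: "metric \<Rightarrow> real^4 \<Rightarrow> real" where
  "ricci_scalar g x = (\<Sum>\<mu>\<in>UNIV. \<Sum>\<nu>\<in>UNIV. ginv g x $ \<mu> $ \<nu> * ricci g \<mu> \<nu> x)"

definition hessian :: "metric \<Rightarrow> (real^4 \<Rightarrow> real) \<Rightarrow> 4 \<Rightarrow> 4 \<Rightarrow> real^4 \<Rightarrow> real" where
  "hessian g \<phi> \<mu> \<nu> x = pd \<mu> (pd \<nu> \<phi>) x - (\<Sum>\<alpha>\<in>UNIV. christoffel g \<alpha> \<mu> \<nu> x * pd \<alpha> \<phi> x)"

definition dalembertian :: "metric \<Rightarrow> (real^4 \<Rightarrow> real) \<Rightarrow> real^4 \<Rightarrow> real" where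
  "dalembertian g \<phi> x = (\<Sum>\<mu>\<in>UNIV. \<Sum>\<nu>\<in>UNIV. ginv g x $ \<mu> $ \<nu> * hessian g \<phi> \<mu> \<nu> x)"

section \<open>Metric f(R) gravity\<close>

definition fR_field_eqs ::
    "(real \<Rightarrow> real) \<Rightarrow> real \<Rightarrow> metric \<Rightarrow> (real^4 \<Rightarrow> real^4^4) \<Rightarrow> real^4 \<Rightarrow> bool" where
  "fR_field_eqs f \<kappa> g T x \<longleftrightarrow>
     (let \<phi> = (\<lambda>z. deriv f (ricci_scalar g z)) in
      \<forall>\<mu> \<nu>. \<phi> x * ricci g \<mu> \<nu> x - (1/2) * f (ricci_scalar g x) * g x $ \<mu> $ \<nu>
             + (hessian g \<phi> \<mu> \<nu> x - g x $ \<mu> $ \<nu> * dalembertian g \<phi> x)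
           = - \<kappa> * T x $ \<mu> $ \<nu>)"

text \<open>Stress-energy \<open>\<rho> u\<^sub>\<mu> u\<^sub>\<nu>\<close> of dust with energy density \<open>\<rho>\<close> and four-velocity \<open>u\<^sup>\<mu>\<close>.\<close>

definition dust_stress :: "metric \<Rightarrow> (real^4 \<Rightarrow> real) \<Rightarrow> (real^4 \<Rightarrow> real^4) \<Rightarrow> real^4 \<Rightarrow> real^4^4" where
  "dust_stress g \<rho> u x = (\<chi> \<mu> \<nu>. \<rho> x * (g x *v u x) $ \<mu> * (g x *v u x) $ \<nu>)"

section \<open>The collapsing dust star\<close>

text \<open>Coordinates \<open>(\<tau>, \<chi>, \<theta>, \<phi>)\<close>, indexed by \<open>1, 2, 3, 4\<close>.\<close>

definition interior_metric :: "real \<Rightarrow> (real \<Rightarrow> real) \<Rightarrow> metric" where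
  "interior_metric k a x = (\<chi> \<mu> \<nu>. if \<mu> = \<nu> then
     (vector [1,
              - (a (x$1))\<^sup>2 / (1 - k * (x$2)\<^sup>2),
              - (a (x$1))\<^sup>2 * (x$2)\<^sup>2,
              - (a (x$1))\<^sup>2 * (x$2)\<^sup>2 * (sin (x$3))\<^sup>2] :: real^4) $ \<mu> else 0)"

text \<open>The centre \<open>\<chi> = 0\<close> and the axis \<open>sin \<theta> = 0\<close> are not covered by spherical coordinates.\<close>

definition interior_region :: "real \<Rightarrow> real \<Rightarrow> (real^4) set" where
  "interior_region \<tau>c \<chi>s = {x. 0 \<le> x$1 \<and> x$1 < \<tau>c \<and> 0 < x$2 \<and> x$2 \<le> \<chi>s \<and> 0 < x$3 \<and> x$3 < pi}"

definition collapsing_dust_star ::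
    "(real \<Rightarrow> real) \<Rightarrow> real set \<Rightarrow> real \<Rightarrow> real \<Rightarrow> real \<Rightarrow> real \<Rightarrow> real \<Rightarrow> (real \<Rightarrow> real) \<Rightarrow> bool" where
  "collapsing_dust_star f I \<kappa> k \<rho>0 \<chi>s \<tau>c a \<longleftrightarrow>
     \<rho>0 > 0 \<and> \<chi>s > 0 \<and> 1 - k * \<chi>s\<^sup>2 > 0 \<and> \<tau>c > 0 \<and>
     smooth_on {0..<\<tau>c} a \<and> (\<forall>\<tau>\<in>{0..<\<tau>c}. a \<tau> > 0) \<and>
     a 0 = 1 \<and> deriv a 0 = 0 \<and> (\<forall>\<tau>\<in>{0<..<\<tau>c}. deriv a \<tau> < 0) \<and>
     (\<forall>x\<in>interior_region \<tau>c \<chi>s.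
        ricci_scalar (interior_metric k a) x \<in> I \<and>
        fR_field_eqs f \<kappa> (interior_metric k a)
          (dust_stress (interior_metric k a) (\<lambda>z. \<rho>0 / (a (z$1))^3) (\<lambda>z. axis 1 1)) x)"

section \<open>The vacuum exterior\<close>

text \<open>Coordinates \<open>(t, r, \<theta>, \<phi>)\<close>, indexed by \<open>1, 2, 3, 4\<close>; \<open>E\<close> is the region covered by
  the exterior in the \<open>(t, r)\<close> half-plane. It will contain boundary points (the stellar surface), and
  \<open>E \<subseteq> closure (interior E)\<close> ensures that derivatives there are determined by the values on \<open>E\<close>.\<close>

definition exterior_metric :: "(real \<times> real \<Rightarrow> real) \<Rightarrow> (real \<times> real \<Rightarrow> real) \<Rightarrow> metric" where
  "exterior_metric A B x = (\<chi> \<mu> \<nu>. if \<mu> = \<nu> then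
     (vector [A (x$1, x$2),
              - B (x$1, x$2),
              - (x$2)\<^sup>2,
              - (x$2)\<^sup>2 * (sin (x$3))\<^sup>2] :: real^4) $ \<mu> else 0)"

definition exterior_region :: "(real \<times> real) set \<Rightarrow> (real^4) set" where
  "exterior_region E = {x. (x$1, x$2) \<in> E \<and> 0 < x$3 \<and> x$3 < pi}"

definition vacuum_exterior ::
    "(real \<Rightarrow> real) \<Rightarrow> real set \<Rightarrow> real \<Rightarrow> (real \<times> real) set \<Rightarrow>
     (real \<times> real \<Rightarrow> real) \<Rightarrow> (real \<times> real \<Rightarrow> real) \<Rightarrow> bool" where
  "vacuum_exterior f I \<kappa> E A B \<longleftrightarrow>
     E \<subseteq> closure (interior E) \<and> (\<forall>(t, r)\<in>E. r > 0) \<and>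
     smooth_on E A \<and> smooth_on E B \<and> (\<forall>p\<in>E. A p > 0 \<and> B p > 0) \<and>
     (\<forall>x\<in>exterior_region E.
        ricci_scalar (exterior_metric A B) x \<in> I \<and>
        fR_field_eqs f \<kappa> (exterior_metric A B) (\<lambda>z. 0) x)"

section \<open>Junction conditions\<close>

text \<open>A hypersurface is given by an embedding \<open>X\<close> of the intrinsic coordinates
  \<open>(\<tau>, \<theta>, \<phi>)\<close>, indexed by \<open>1, 2, 3\<close>, into the coordinate chart.\<close>

definition tangent :: "(real^3 \<Rightarrow> real^4) \<Rightarrow> 3 \<Rightarrow> real^3 \<Rightarrow> real^4" where
  "tangent X a y = (\<chi> \<mu>. pd a (\<lambda>w. X w $ \<mu>) y)"

definition induced_metric :: "metric \<Rightarrow> (real^3 \<Rightarrow> real^4) \<Rightarrow> 3 \<Rightarrow> 3 \<Rightarrow> real^3 \<Rightarrow> real" where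
  "induced_metric g X a b y = tangent X a y \<bullet> (g (X y) *v tangent X b y)"

text \<open>The unit normal of a timelike hypersurface is spacelike, hence of square \<open>-1\<close> in
  signature \<open>(+,-,-,-)\<close>. Of the two opposite unit normals the one directed from the interior to the
  exterior is taken, that is towards increasing radial coordinate (index \<open>2\<close>) on both sides.\<close>

definition unit_normal :: "metric \<Rightarrow> (real^3 \<Rightarrow> real^4) \<Rightarrow> real^3 \<Rightarrow> real^4" where
  "unit_normal g X y = (THE n.
     (\<forall>a. n \<bullet> (g (X y) *v tangent X a y) = 0) \<and> n \<bullet> (g (X y) *v n) = -1 \<and> n $ 2 > 0)"

text \<open>\<open>K\<^sub>a\<^sub>b = e\<^sub>a\<^sup>\<mu> e\<^sub>b\<^sup>\<nu> \<nabla>\<^sub>\<mu> n\<^sub>\<nu>\<close>, where \<open>e\<^sub>a\<^sup>\<mu> \<partial>\<^sub>\<mu> n\<^sub>\<nu>\<close> is the derivative of \<open>n\<^sub>\<nu>\<close> along the hypersurface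
  with respect to the intrinsic coordinate \<open>y\<^sup>a\<close>.\<close>

definition extrinsic_curvature :: "metric \<Rightarrow> (real^3 \<Rightarrow> real^4) \<Rightarrow> 3 \<Rightarrow> 3 \<Rightarrow> real^3 \<Rightarrow> real" where
  "extrinsic_curvature g X a b y =
     (\<Sum>\<nu>\<in>UNIV. tangent X b y $ \<nu> *
        (pd a (\<lambda>w. (g (X w) *v unit_normal g X w) $ \<nu>) y
         - (\<Sum>\<mu>\<in>UNIV. \<Sum>\<alpha>\<in>UNIV. christoffel g \<alpha> \<mu> \<nu> (X y)
              * (g (X y) *v unit_normal g X y) $ \<alpha> * tangent X a y $ \<mu>)))"

definition normal_derivative ::
    "metric \<Rightarrow> (real^3 \<Rightarrow> real^4) \<Rightarrow> (real^4 \<Rightarrow> real) \<Rightarrow> real^3 \<Rightarrow> real" where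
  "normal_derivative g X \<phi> y = (\<Sum>\<mu>\<in>UNIV. unit_normal g X y $ \<mu> * pd \<mu> \<phi> (X y))"

definition junction_conditions ::
    "metric \<Rightarrow> (real^3 \<Rightarrow> real^4) \<Rightarrow> metric \<Rightarrow> (real^3 \<Rightarrow> real^4) \<Rightarrow> real^3 \<Rightarrow> bool" where
  "junction_conditions gm Xm gp Xp y \<longleftrightarrow>
     (\<forall>a b. induced_metric gp Xp a b y = induced_metric gm Xm a b y) \<and>
     (\<forall>a b. extrinsic_curvature gp Xp a b y = extrinsic_curvature gm Xm a b y) \<and>
     ricci_scalar gp (Xp y) = ricci_scalar gm (Xm y) \<and>
     normal_derivative gp Xp (ricci_scalar gp) y = normal_derivative gm Xm (ricci_scalar gm) y"

definition interior_embedding :: "real \<Rightarrow> real^3 \<Rightarrow> real^4" where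
  "interior_embedding \<chi>s y = vector [y$1, \<chi>s, y$2, y$3]"

definition exterior_embedding :: "(real \<Rightarrow> real) \<Rightarrow> (real \<Rightarrow> real) \<Rightarrow> real^3 \<Rightarrow> real^4" where
  "exterior_embedding ts rs y = vector [ts (y$1), rs (y$1), y$2, y$3]"

text \<open>The fourth conjunct says that the exterior lies outside the surface
  and is bounded by it: \<open>E\<close> contains a one-sided neighbourhood \<open>r \<ge> r\<^sub>*\<close> of the curve
  \<open>(t\<^sub>*(\<tau>), r\<^sub>*(\<tau>))\<close>. What \<open>E\<close> looks like elsewhere is left open.\<close>

definition smoothly_matched ::
    "real \<Rightarrow> (real \<Rightarrow> real) \<Rightarrow> real \<Rightarrow> real \<Rightarrow> (real \<times> real) set \<Rightarrow>
     (real \<times> real \<Rightarrow> real) \<Rightarrow> (real \<times> real \<Rightarrow> real) \<Rightarrow> bool" where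
  "smoothly_matched k a \<tau>c \<chi>s E A B \<longleftrightarrow>
     (\<exists>ts rs. smooth_on {0..<\<tau>c} ts \<and> smooth_on {0..<\<tau>c} rs \<and>
        (\<forall>\<tau>\<in>{0..<\<tau>c}. deriv ts \<tau> > 0) \<and>
        (\<forall>\<tau>\<in>{0..<\<tau>c}. \<exists>\<epsilon>>0. \<forall>\<tau>'\<in>{0..<\<tau>c}. \<forall>r.
            \<bar>\<tau>' - \<tau>\<bar> < \<epsilon> \<and> rs \<tau>' \<le> r \<and> r < rs \<tau>' + \<epsilon> \<longrightarrow> (ts \<tau>', r) \<in> E) \<and>
        (\<forall>y. 0 \<le> y$1 \<and> y$1 < \<tau>c \<and> 0 < y$2 \<and> y$2 < pi \<longrightarrow>
            junction_conditions (interior_metric k a) (interior_embedding \<chi>s)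
              (exterior_metric A B) (exterior_embedding ts rs) y))"

end

theory Submission
  imports Defs
begin

text \<open>On the surface, \<open>[h\<^sub>\<theta>\<^sub>\<theta>] = 0\<close> gives \<open>r\<^sub>* = \<chi>\<^sub>* a\<close>, which is strictly decreasing, so
  both components \<open>n\<^sup>t < 0 < n\<^sup>r\<close> of the exterior unit normal are nonzero. The interior curvature
  \<open>R\<^sup>-\<close> depends on \<open>\<tau>\<close> only, so the last junction condition reads
  \<open>n\<^sup>t \<partial>\<^sub>t R\<^sup>+ + n\<^sup>r \<partial>\<^sub>r R\<^sup>+ = 0\<close>. If \<open>R\<^sup>+\<close> depends on one coordinate only, then one of the two terms
  vanishes, hence so does the other, and \<open>[R] = 0\<close> makes \<open>R\<^sup>-\<close> constant in \<open>\<tau>\<close>. The trace of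
  the interior field equations then reads \<open>f\<^sub>R R - 2 f = - \<kappa> \<rho>\<^sub>0 / a\<^sup>3\<close> with a constant left-hand
  side, contradicting \<open>a' < 0\<close>. Since \<open>E\<close> lies on one side of the surface, the two-sided derivatives of \<open>R\<^sup>+\<close> there are
  identified with one-sided ones along curves in \<open>E\<close>.\<close>

section \<open>Calculus of smooth functions\<close>

lemma Ck_on_Suc_mono:
  assumes "Ck_on (Suc n) U h"
  shows "Ck_on n U h"
  using assms
proof (induction n arbitrary: h)
  case 0
  then have "h differentiable_on U"
    by (simp add: differentiable_at_imp_differentiable_on)
  then show ?case by (simp add: differentiable_imp_continuous_on)
next
  case (Suc n)
  then show ?case by (metis Ck_on.simps(2))
qed

text \<open>Derivatives at a point of an open set only see values on that set, so agreement on
  \<open>U\<close> passes to \<open>frechet_derivative\<close> and the induction goes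
  through.\<close>

lemma Ck_on_cong:
  assumes "open U" "\<And>x. x \<in> U \<Longrightarrow> f x = g x" "Ck_on n U f"
  shows "Ck_on n U g"
  using assms(2,3)
proof (induction n arbitrary: f g)
  case 0
  then show ?case using continuous_on_cong by force
next
  case (Suc n)
  have g: "(g has_derivative frechet_derivative f (at x)) (at x)" if "x \<in> U" for x
    using Suc.prems that \<open>open U\<close>
    by (metis Ck_on.simps(2) frechet_derivative_works has_derivative_transform_within_open)
  have "Ck_on n U (\<lambda>x. frechet_derivative g (at x) v)" for v
  proof (rule Suc.IH)
    show "frechet_derivative f (at x) v = frechet_derivative g (at x) v" if "x \<in> U" for x
      using frechet_derivative_at[OF g[OF that]] by simp
  qed (use Suc.prems in auto)
  then show ?case using g by (auto simp: differentiable_def)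
qed

text \<open>\<open>frechet_derivative\<close> is a choice operator, but on \<open>U\<close> it must
  agree with any explicit derivative \<open>D\<close>. The closure rules below can thus run their
  inductions on the usual formulas for sums, products and inverses.\<close>

lemma Ck_on_SucI:
  assumes "open U" "\<And>x. x \<in> U \<Longrightarrow> (h has_derivative D x) (at x)"
    and "\<And>v. Ck_on n U (\<lambda>x. D x v)"
  shows "Ck_on (Suc n) U h"
proof -
  have "Ck_on n U (\<lambda>x. frechet_derivative h (at x) v)" for v
    by (rule Ck_on_cong[OF assms(1) _ assms(3)[of v]])
      (simp add: frechet_derivative_at[OF assms(2)])
  then show ?thesis using assms(2) by (auto simp: differentiable_def)
qed

lemma Ck_on_has_derivative:
  assumes "Ck_on (Suc n) U h" "x \<in> U"
  shows "(h has_derivative frechet_derivative h (at x)) (at x)"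
  using assms frechet_derivative_works by auto

lemma Ck_on_subset: "Ck_on n U h \<Longrightarrow> V \<subseteq> U \<Longrightarrow> Ck_on n V h"
  by (induction n arbitrary: h) (auto intro: continuous_on_subset)

lemma Ck_on_const: "open U \<Longrightarrow> Ck_on n U (\<lambda>x. c)"
proof (induction n arbitrary: c)
  case (Suc n)
  show ?case
    by (rule Ck_on_SucI[where D = "\<lambda>x v. 0"]) (use Suc in auto)
qed simp

lemma Ck_on_add:
  assumes "open U" "Ck_on n U f" "Ck_on n U g"
  shows "Ck_on n U (\<lambda>x. f x + g x)"
  using assms(2,3)
proof (induction n arbitrary: f g)
  case (Suc n)
  show ?case
    by (rule Ck_on_SucI[OF \<open>open U\<close> has_derivative_add[OF Ck_on_has_derivative Ck_on_has_derivative]])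
      (use Suc in auto)
qed (auto intro: continuous_intros)

lemma Ck_on_mult:
  assumes "open U" "Ck_on n U f" "Ck_on n U g"
  shows "Ck_on n U (\<lambda>x. f x * g x)"
  using assms(2,3)
proof (induction n arbitrary: f g)
  case (Suc n)
  show ?case
    by (rule Ck_on_SucI[OF \<open>open U\<close> has_derivative_mult[OF Ck_on_has_derivative Ck_on_has_derivative]])
      (use Suc Ck_on_Suc_mono[OF Suc.prems(1)] Ck_on_Suc_mono[OF Suc.prems(2)] in
        \<open>auto intro!: Ck_on_add[OF \<open>open U\<close>]\<close>)
qed (auto intro: continuous_intros)

lemma Ck_on_inverse:
  assumes "open U" "Ck_on n U f" "\<And>x. x \<in> U \<Longrightarrow> f x \<noteq> 0"
  shows "Ck_on n U (\<lambda>x. inverse (f x))"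
  using assms(2,3)
proof (induction n arbitrary: f)
  case (Suc n)
  \<comment> \<open>The derivative -(1/f) Df (1/f) contains 1/f again, which is therefore needed one
    order lower.\<close>
  have IH: "Ck_on n U (\<lambda>x. inverse (f x))" using Suc Ck_on_Suc_mono by blast
  have "Ck_on n U (\<lambda>x. frechet_derivative f (at x) v)" for v using Suc by auto
  then have D: "Ck_on n U (\<lambda>x. (- 1) * (inverse (f x) * frechet_derivative f (at x) v * inverse (f x)))" for v
    using IH by (intro Ck_on_mult Ck_on_const \<open>open U\<close>)
  show ?case
    by (rule Ck_on_SucI[OF \<open>open U\<close> Deriv.has_derivative_inverse[OF _ Ck_on_has_derivative]])
      (use Suc D in auto)
qed (auto intro: continuous_intros)

text \<open>The derivative in direction \<open>v\<close> is Dh(L x) applied to the fixed vector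
  \<open>L v\<close>, which is again a function composed with \<open>L\<close>; so the induction
  closes without a higher-order chain rule. The coordinate projections are the intended
  \<open>L\<close>.\<close>

lemma Ck_on_compose_linear:
  fixes L :: "'a::real_normed_vector \<Rightarrow> 'b::real_normed_vector"
  assumes "open W" "bounded_linear L" "L ` W \<subseteq> U" "Ck_on n U h"
  shows "Ck_on n W (\<lambda>x. h (L x))"
  using assms(4)
proof (induction n arbitrary: h)
  case 0
  then show ?case
    using assms by (auto intro: continuous_on_compose2 linear_continuous_on)
next
  case (Suc n)
  have *: "((\<lambda>x. h (L x)) has_derivative (\<lambda>v. frechet_derivative h (at (L x)) (L v))) (at x)"
    if "x \<in> W" for x
    using that assms(3) Suc.prems
    by (intro has_derivative_compose[OF bounded_linear_imp_has_derivative[OF assms(2)]]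
        Ck_on_has_derivative) auto
  show ?case
    by (rule Ck_on_SucI[OF \<open>open W\<close> *]) (use Suc in auto)
qed

lemma Ck_on_bounded_linear:
  assumes "open U" "bounded_linear L"
  shows "Ck_on n U L"
proof (cases n)
  case 0
  then show ?thesis using assms by (simp add: linear_continuous_on)
next
  case (Suc m)
  show ?thesis unfolding Suc
    by (rule Ck_on_SucI[OF assms(1) bounded_linear_imp_has_derivative[OF assms(2)]])
      (rule Ck_on_const[OF assms(1)])
qed

text \<open>Each function is, up to sign, the derivative of the other, hence the joint
  induction.\<close>

lemma Ck_on_sin_cos:
  assumes "open U"
  shows "Ck_on n U sin \<and> Ck_on n U (cos :: real \<Rightarrow> real)"
proof (induction n)
  case (Suc n)
  have s: "Ck_on n U (\<lambda>x. cos x * v)" for v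
    using Suc by (intro Ck_on_mult Ck_on_const assms) auto
  have c: "Ck_on n U (\<lambda>x. (- sin x) * v)" for v
    using Suc Ck_on_mult[OF assms Ck_on_const[OF assms, of n "- v"], of sin]
    by (simp add: mult.commute)
  have "Ck_on (Suc n) U sin"
    by (rule Ck_on_SucI[OF assms _ s]) (auto intro!: derivative_eq_intros)
  moreover have "Ck_on (Suc n) U (cos :: real \<Rightarrow> real)"
    by (rule Ck_on_SucI[OF assms _ c]) (auto intro!: derivative_eq_intros)
  ultimately show ?case ..
qed (auto intro: continuous_intros)

text \<open>In contrast to \<open>smooth_on\<close>, openness is part of the predicate: the closure
  rules pass it along, and derivatives are smooth on the same set.\<close>

definition smooth :: "'a::real_normed_vector set \<Rightarrow> ('a \<Rightarrow> real) \<Rightarrow> bool" where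
  "smooth U h \<longleftrightarrow> open U \<and> (\<forall>n. Ck_on n U h)"

lemma smooth_const: "open U \<Longrightarrow> smooth U (\<lambda>x. c)"
  and smooth_add: "smooth U f \<Longrightarrow> smooth U g \<Longrightarrow> smooth U (\<lambda>x. f x + g x)"
  and smooth_mult: "smooth U f \<Longrightarrow> smooth U g \<Longrightarrow> smooth U (\<lambda>x. f x * g x)"
  and smooth_inverse: "smooth U f \<Longrightarrow> (\<And>x. x \<in> U \<Longrightarrow> f x \<noteq> 0) \<Longrightarrow> smooth U (\<lambda>x. inverse (f x))"
  by (simp_all add: smooth_def Ck_on_const Ck_on_add Ck_on_mult Ck_on_inverse)

lemma smooth_cong:
  assumes "smooth U f" "\<And>x. x \<in> U \<Longrightarrow> f x = g x"
  shows "smooth U g"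
  using assms Ck_on_cong unfolding smooth_def by blast

lemma smooth_minus: "smooth U f \<Longrightarrow> smooth U (\<lambda>x. - f x)"
  using smooth_mult[OF smooth_const, of U f "- 1"] by (simp add: smooth_def)

lemma smooth_diff: "smooth U f \<Longrightarrow> smooth U g \<Longrightarrow> smooth U (\<lambda>x. f x - g x)"
  using smooth_add[OF _ smooth_minus, of U f g] by simp

lemma smooth_power: "smooth U f \<Longrightarrow> smooth U (\<lambda>x. f x ^ n)"
proof (induction n)
  case 0
  then show ?case using smooth_const[of U 1] by (simp add: smooth_def)
next
  case (Suc n)
  then show ?case using smooth_mult[of U f] by simp
qed

lemma smooth_sum:
  assumes "open U" "\<And>i. i \<in> S \<Longrightarrow> smooth U (f i)"
  shows "smooth U (\<lambda>x. \<Sum>i\<in>S. f i x)"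
  using assms(2)
  by (induction S rule: infinite_finite_induct) (auto intro: smooth_add smooth_const assms(1))

lemma smooth_differentiable: "smooth U h \<Longrightarrow> x \<in> U \<Longrightarrow> h differentiable (at x)"
  unfolding smooth_def by (metis Ck_on.simps(2))

text \<open>\<open>pd\<close> is a total operator; smoothness makes it a genuine derivative, namely
  the Frechet derivative in an axis direction.\<close>

lemma smooth_line:
  assumes "smooth U h" "x \<in> U"
  shows "((\<lambda>s. h (x + s *\<^sub>R axis \<mu> 1)) has_real_derivative pd \<mu> h x) (at 0)"
    and "pd \<mu> h x = frechet_derivative h (at x) (axis \<mu> 1)"
proof -
  let ?D = "frechet_derivative h (at x)"
  have D: "(h has_derivative ?D) (at (x + 0 *\<^sub>R axis \<mu> 1))"
    using assms smooth_differentiable frechet_derivative_works by force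
  have "((\<lambda>s. x + s *\<^sub>R axis \<mu> 1) has_derivative (\<lambda>s. s *\<^sub>R axis \<mu> 1)) (at 0)"
    by (auto intro!: derivative_eq_intros)
  from has_derivative_compose[OF this D]
  have "((\<lambda>s. h (x + s *\<^sub>R axis \<mu> 1)) has_derivative (\<lambda>s. ?D (s *\<^sub>R axis \<mu> 1))) (at 0)" .
  moreover have "?D (s *\<^sub>R axis \<mu> 1) = ?D (axis \<mu> 1) * s" for s
    using has_derivative_linear[OF D] by (simp add: linear_cmul)
  ultimately have *: "((\<lambda>s. h (x + s *\<^sub>R axis \<mu> 1)) has_real_derivative ?D (axis \<mu> 1)) (at 0)"
    by (simp add: has_field_derivative_def)
  show "pd \<mu> h x = ?D (axis \<mu> 1)"
    unfolding pd_def using * by (rule DERIV_imp_deriv)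
  with * show "((\<lambda>s. h (x + s *\<^sub>R axis \<mu> 1)) has_real_derivative pd \<mu> h x) (at 0)" by simp
qed

lemma smooth_pd:
  assumes "smooth U h"
  shows "smooth U (pd \<mu> h)"
proof (rule smooth_cong)
  show "smooth U (\<lambda>x. frechet_derivative h (at x) (axis \<mu> 1))"
    using assms unfolding smooth_def by (metis Ck_on.simps(2))
qed (simp add: smooth_line(2)[OF assms])

text \<open>For small \<open>s\<close> the coordinate line stays in \<open>U\<close>, so
  \<open>pd\<close> is local. This is what permits differentiating closed formulas that hold only on
  the domain of a chart.\<close>

lemma pd_cong_open:
  assumes "open U" "x \<in> U" "\<And>z. z \<in> U \<Longrightarrow> f z = g z"
  shows "pd \<mu> f x = pd \<mu> g x"
proof -
  have "((\<lambda>s. x + s *\<^sub>R axis \<mu> (1::real)) \<longlongrightarrow> x + 0 *\<^sub>R axis \<mu> 1) (nhds 0)"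
    by (intro tendsto_intros filterlim_ident)
  then have "\<forall>\<^sub>F s in nhds 0. x + s *\<^sub>R axis \<mu> 1 \<in> U"
    using assms(1,2) by (simp add: topological_tendstoD)
  then have "\<forall>\<^sub>F s in nhds 0. f (x + s *\<^sub>R axis \<mu> 1) = g (x + s *\<^sub>R axis \<mu> 1)"
    by eventually_elim (rule assms(3))
  then show ?thesis unfolding pd_def by (intro deriv_cong_ev) auto
qed

lemma smooth_deriv:
  fixes h :: "real \<Rightarrow> real"
  assumes "smooth U h"
  shows "smooth U (deriv h)"
    and "x \<in> U \<Longrightarrow> (h has_real_derivative deriv h x) (at x)"
proof -
  have D: "(h has_real_derivative deriv h x) (at x)" if "x \<in> U" for x
    using smooth_differentiable[OF assms that] DERIV_deriv_iff_real_differentiable by blast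
  then show "x \<in> U \<Longrightarrow> (h has_real_derivative deriv h x) (at x)" .
  show "smooth U (deriv h)"
  proof (rule smooth_cong)
    show "smooth U (\<lambda>x. frechet_derivative h (at x) 1)"
      using assms unfolding smooth_def by (metis Ck_on.simps(2))
    show "frechet_derivative h (at x) 1 = deriv h x" if "x \<in> U" for x
      using frechet_derivative_at[OF D[OF that, unfolded has_field_derivative_def]]
      by (metis mult.right_neutral)
  qed
qed

section \<open>Diagonal metrics\<close>

text \<open>The body copies the shape of \<open>interior_metric\<close> and
  \<open>exterior_metric\<close>, so that both unfold to instances of it.\<close>

definition diag4 :: "real \<Rightarrow> real \<Rightarrow> real \<Rightarrow> real \<Rightarrow> real^4^4" where
  "diag4 p q r s = (\<chi> \<mu> \<nu>. if \<mu> = \<nu> then vector [p, q, r, s] $ \<mu> else 0)"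

lemma vector4_nth:
  "(vector [p, q, r, s] :: real^4) $ 1 = p" "(vector [p, q, r, s] :: real^4) $ 2 = q"
  "(vector [p, q, r, s] :: real^4) $ 3 = r" "(vector [p, q, r, s] :: real^4) $ 4 = s"
  by (simp_all add: vector_def)

lemma diag4_nth:
  "diag4 p q r s $ 1 $ 1 = p" "diag4 p q r s $ 2 $ 2 = q"
  "diag4 p q r s $ 3 $ 3 = r" "diag4 p q r s $ 4 $ 4 = s"
  "\<mu> \<noteq> \<nu> \<Longrightarrow> diag4 p q r s $ \<mu> $ \<nu> = 0"
  by (simp_all add: diag4_def vector4_nth)

lemma neq4:
  "(1::4) \<noteq> 2" "(1::4) \<noteq> 3" "(1::4) \<noteq> 4" "(2::4) \<noteq> 1" "(2::4) \<noteq> 3" "(2::4) \<noteq> 4"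
  "(3::4) \<noteq> 1" "(3::4) \<noteq> 2" "(3::4) \<noteq> 4" "(4::4) \<noteq> 1" "(4::4) \<noteq> 2" "(4::4) \<noteq> 3"
  by simp_all

lemma diag4_mult: "diag4 p q r s ** diag4 p' q' r' s' = diag4 (p * p') (q * q') (r * r') (s * s')"
  by (simp add: vec_eq_iff matrix_matrix_mult_def forall_4 sum_4 diag4_nth neq4)

lemma diag4_mv: "diag4 p q r s *v n = vector [p * n $ 1, q * n $ 2, r * n $ 3, s * n $ 4]"
  by (simp add: vec_eq_iff matrix_vector_mult_def forall_4 sum_4 diag4_nth neq4 vector4_nth)

lemma diag4_one: "diag4 1 1 1 1 = mat 1"
  by (simp add: vec_eq_iff mat_def forall_4 diag4_nth neq4)

lemma matrix_inv_diag4: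
  assumes "p \<noteq> 0" "q \<noteq> 0" "r \<noteq> 0" "s \<noteq> 0"
  shows "matrix_inv (diag4 p q r s) = diag4 (inverse p) (inverse q) (inverse r) (inverse s)"
    (is "?M' = ?N")
proof -
  let ?M = "diag4 p q r s"
  have MN: "?M ** ?N = mat 1" and NM: "?N ** ?M = mat 1"
    using assms by (simp_all only: diag4_mult right_inverse left_inverse diag4_one not_False_eq_True)
  \<comment> \<open>\<open>matrix_inv\<close> is a Hilbert choice; the witness \<open>?N\<close>
    shows that the chosen matrix is an inverse, and associativity then identifies it with
    \<open>?N\<close>.\<close>
  have "?M' ** ?M = mat 1"
    unfolding matrix_inv_def
    by (rule someI2[where a = ?N and P = "\<lambda>N. ?M ** N = mat 1 \<and> N ** ?M = mat 1"])
      (use MN NM in auto)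
  then have "(?M' ** ?M) ** ?N = ?N" by (simp only: matrix_mul_lid)
  then show ?thesis by (simp only: matrix_mul_assoc[symmetric] MN matrix_mul_rid)
qed

lemma exterior_metric_diag4:
  "exterior_metric A B x =
     diag4 (A (x$1, x$2)) (- B (x$1, x$2)) (- (x$2)\<^sup>2) (- (x$2)\<^sup>2 * (sin (x$3))\<^sup>2)"
  by (simp only: exterior_metric_def diag4_def)

lemma interior_metric_diag4:
  "interior_metric k a x =
     diag4 1 (- (a (x$1))\<^sup>2 / (1 - k * (x$2)\<^sup>2)) (- (a (x$1))\<^sup>2 * (x$2)\<^sup>2)
       (- (a (x$1))\<^sup>2 * (x$2)\<^sup>2 * (sin (x$3))\<^sup>2)"
  by (simp only: interior_metric_def diag4_def)

section \<open>Smoothness of the scalar curvature\<close>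

text \<open>The curvature arises from the metric, its inverse and partial derivatives by sums and
  products with smooth factors; every division is hidden in \<open>ginv\<close>.\<close>

lemma smooth_ricci_scalar:
  assumes "open W" and g: "\<And>\<mu> \<nu>. smooth W (\<lambda>x. g x $ \<mu> $ \<nu>)"
    and gi: "\<And>\<mu> \<nu>. smooth W (\<lambda>x. ginv g x $ \<mu> $ \<nu>)"
  shows "smooth W (ricci_scalar g)"
proof -
  have Gam: "smooth W (christoffel g \<rho> \<mu> \<nu>)" for \<rho> \<mu> \<nu>
    unfolding christoffel_def[abs_def]
    by (intro smooth_mult smooth_const smooth_sum smooth_diff smooth_add smooth_pd assms)
  have "smooth W (riemann g \<rho> \<sigma> \<mu> \<nu>)" for \<rho> \<sigma> \<mu> \<nu>
    unfolding riemann_def[abs_def]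
    by (intro smooth_mult smooth_sum smooth_diff smooth_add smooth_pd Gam \<open>open W\<close>)
  then show ?thesis
    unfolding ricci_scalar_def[abs_def] ricci_def
    by (intro smooth_mult smooth_sum gi \<open>open W\<close>)
qed

lemma smooth_diag4_nth:
  assumes "smooth W p" "smooth W q" "smooth W r" "smooth W s"
  shows "smooth W (\<lambda>x. diag4 (p x) (q x) (r x) (s x) $ \<mu> $ \<nu>)"
proof (cases "\<mu> = \<nu>")
  case True
  then show ?thesis using assms exhaust_4[of \<mu>] by (auto simp: diag4_nth)
next
  case False
  moreover have "open W" using assms(1) by (simp add: smooth_def)
  ultimately show ?thesis by (simp add: diag4_nth smooth_const)
qed

lemma smooth_nth: "open W \<Longrightarrow> smooth W (\<lambda>x::real^4. x $ i)"
  using Ck_on_bounded_linear[OF _ bounded_linear_vec_nth] by (auto simp: smooth_def)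

text \<open>The field equations only constrain the metric on \<open>E\<close>, but its smooth extension off \<open>E\<close>
  makes the scalar curvature differentiable (two-sidedly) at boundary points as well.\<close>

lemma exterior_ricci_scalar_smooth:
  assumes "vacuum_exterior f I \<kappa> E A B"
  obtains W where "exterior_region E \<subseteq> W" "smooth W (ricci_scalar (exterior_metric A B))"
proof -
  obtain U V where U: "open U" "E \<subseteq> U" "\<And>n. Ck_on n U A" and V: "open V" "E \<subseteq> V" "\<And>n. Ck_on n V B"
    using assms unfolding vacuum_exterior_def smooth_on_def by metis
  \<comment> \<open>Off \<open>E\<close> the extensions of \<open>A\<close> and \<open>B\<close> may
    change sign, so the domain is cut down to where both are positive. \<open>W\<close> below adds r
    > 0 and 0 < \<theta> < \<pi>, which keeps all diagonal entries of the metric nonzero.\<close>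
  define D where "D = {p \<in> U \<inter> V. A p > 0} \<inter> {p \<in> U \<inter> V. B p > 0}"
  have "open {p \<in> U \<inter> V. h p > 0}" if "continuous_on (U \<inter> V) h" for h :: "real \<times> real \<Rightarrow> real"
  proof -
    have "{p \<in> U \<inter> V. h p > 0} = U \<inter> V \<inter> h -` {0<..}" by auto
    then show ?thesis
      using continuous_open_preimage[OF that open_Int[OF U(1) V(1)] open_greaterThan] by simp
  qed
  moreover have "continuous_on (U \<inter> V) A" "continuous_on (U \<inter> V) B"
    using U(3)[of 0] V(3)[of 0] by (auto intro: continuous_on_subset)
  ultimately have "open D" unfolding D_def by (intro open_Int)
  define L :: "real^4 \<Rightarrow> real \<times> real" where "L = (\<lambda>x. (x$1, x$2))"
  have L: "bounded_linear L"
    unfolding L_def by (intro bounded_linear_Pair bounded_linear_vec_nth)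
  define W where "W = L -` D \<inter> {x. x$2 > 0} \<inter> {x. x$3 > 0} \<inter> {x. x$3 < pi}"
  have "open (L -` D)"
    using \<open>open D\<close> linear_continuous_on[OF L] by (rule open_vimage)
  moreover have "open {x::real^4. x$2 > 0}" "open {x::real^4. x$3 > 0}" "open {x::real^4. x$3 < pi}"
    by (rule open_halfspace_component_gt_cart open_halfspace_component_lt_cart)+
  ultimately have W: "open W" unfolding W_def by (intro open_Int)
  have LW: "L ` W \<subseteq> U" "L ` W \<subseteq> V" unfolding W_def D_def by auto
  have A: "smooth W (\<lambda>x. A (x$1, x$2))" and B: "smooth W (\<lambda>x. B (x$1, x$2))"
    using Ck_on_compose_linear[OF W L LW(1) U(3)] Ck_on_compose_linear[OF W L LW(2) V(3)] W
    by (simp_all add: smooth_def L_def)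
  have S: "smooth W (\<lambda>x. sin (x$3))"
    using Ck_on_compose_linear[OF W bounded_linear_vec_nth, of 3 UNIV _ sin] Ck_on_sin_cos W
    by (simp add: smooth_def)
  have pos: "A (x$1, x$2) > 0" "B (x$1, x$2) > 0" "x$2 > 0" "sin (x$3) > 0" if "x \<in> W" for x
    using that by (auto simp: W_def D_def L_def sin_gt_zero)
  let ?g = "exterior_metric A B"
  let ?c3 = "\<lambda>x::real^4. - (x$2)\<^sup>2" and ?c4 = "\<lambda>x::real^4. - (x$2)\<^sup>2 * (sin (x$3))\<^sup>2"
  have c: "smooth W ?c3" "smooth W ?c4" "smooth W (\<lambda>x. - B (x$1, x$2))"
    by (intro smooth_mult smooth_minus smooth_power smooth_nth W S B)+
  have nz: "A (x$1, x$2) \<noteq> 0" "- B (x$1, x$2) \<noteq> 0" "?c3 x \<noteq> 0" "?c4 x \<noteq> 0"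
    if "x \<in> W" for x
    using pos[OF that] by simp_all
  have gi: "ginv ?g x = diag4 (inverse (A (x$1, x$2))) (inverse (- B (x$1, x$2)))
      (inverse (?c3 x)) (inverse (?c4 x))" if "x \<in> W" for x
    unfolding ginv_def exterior_metric_diag4 by (intro matrix_inv_diag4 nz[OF that])
  have "smooth W (ricci_scalar ?g)"
  proof (rule smooth_ricci_scalar[OF W])
    show "smooth W (\<lambda>x. ?g x $ \<mu> $ \<nu>)" for \<mu> \<nu>
      unfolding exterior_metric_diag4 by (intro smooth_diag4_nth A c)
    show "smooth W (\<lambda>x. ginv ?g x $ \<mu> $ \<nu>)" for \<mu> \<nu>
    proof (rule smooth_cong)
      show "smooth W (\<lambda>x. diag4 (inverse (A (x$1, x$2))) (inverse (- B (x$1, x$2)))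
          (inverse (?c3 x)) (inverse (?c4 x)) $ \<mu> $ \<nu>)"
        by (intro smooth_diag4_nth smooth_inverse A c nz)
    qed (simp add: gi)
  qed
  moreover have "exterior_region E \<subseteq> W"
  proof
    fix x assume "x \<in> exterior_region E"
    then have x: "(x$1, x$2) \<in> E" "0 < x$3" "x$3 < pi" by (auto simp: exterior_region_def)
    moreover have "x$2 > 0" "A (x$1, x$2) > 0" "B (x$1, x$2) > 0"
      using assms x(1) unfolding vacuum_exterior_def by auto
    ultimately show "x \<in> W" using U(2) V(2) by (auto simp: W_def D_def L_def)
  qed
  ultimately show ?thesis using that by blast
qed

section \<open>Curvature of the dust interior\<close>

text \<open>Only the summand \<alpha> = \<rho> survives, the inverse metric being diagonal at
  \<open>x\<close>. The metric itself is diagonal at every point, so that the derivatives of its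
  off-diagonal entries vanish too.\<close>

lemma christoffel_diag:
  assumes g: "\<And>z \<mu> \<nu>. \<mu> \<noteq> \<nu> \<Longrightarrow> g z $ \<mu> $ \<nu> = 0"
    and gi: "\<And>\<mu> \<nu>. \<mu> \<noteq> \<nu> \<Longrightarrow> ginv g x $ \<mu> $ \<nu> = 0"
  shows "christoffel g \<rho> \<mu> \<nu> x = 1/2 * ginv g x $ \<rho> $ \<rho> *
    ((if \<rho> = \<nu> then pd \<mu> (\<lambda>z. g z $ \<rho> $ \<rho>) x else 0)
     + (if \<rho> = \<mu> then pd \<nu> (\<lambda>z. g z $ \<rho> $ \<rho>) x else 0)
     - (if \<mu> = \<nu> then pd \<rho> (\<lambda>z. g z $ \<mu> $ \<mu>) x else 0))"
proof -
  have pd0: "pd \<mu> (\<lambda>z. g z $ \<alpha> $ \<beta>) x = 0" if "\<alpha> \<noteq> \<beta>" for \<mu> \<alpha> \<beta>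
    by (simp add: g[OF that] pd_def)
  have "christoffel g \<rho> \<mu> \<nu> x = 1/2 * (\<Sum>\<alpha>\<in>{\<rho>}. ginv g x $ \<rho> $ \<alpha> *
        (pd \<mu> (\<lambda>z. g z $ \<alpha> $ \<nu>) x + pd \<nu> (\<lambda>z. g z $ \<alpha> $ \<mu>) x - pd \<alpha> (\<lambda>z. g z $ \<mu> $ \<nu>) x))"
    unfolding christoffel_def
    by (intro arg_cong[where f = "(*) (1/2)"] sum.mono_neutral_right) (auto simp: gi)
  then show ?thesis
    by (cases "\<rho> = \<nu>"; cases "\<rho> = \<mu>"; cases "\<mu> = \<nu>") (simp_all add: pd0)
qed

text \<open>The entries of the interior metric and its Christoffel symbols all separate into such
  products, so this one rule yields all their partial derivatives.\<close>

lemma pd_prod: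
  assumes "(p has_real_derivative p') (at (x$1))" "(q has_real_derivative q') (at (x$2))"
    "(w has_real_derivative w') (at (x$3))"
  shows "pd \<mu> (\<lambda>z::real^4. p (z$1) * q (z$2) * w (z$3)) x =
    (if \<mu> = 1 then p' * q (x$2) * w (x$3)
     else if \<mu> = 2 then p (x$1) * q' * w (x$3)
     else if \<mu> = 3 then p (x$1) * q (x$2) * w' else 0)"
proof -
  have line: "((\<lambda>s. x $ i + s * axis \<mu> 1 $ i) has_real_derivative axis \<mu> 1 $ i) (at 0)" for i
    by (auto intro!: derivative_eq_intros)
  have D: "((\<lambda>s. h (x $ i + s * axis \<mu> 1 $ i)) has_real_derivative d * axis \<mu> 1 $ i) (at 0)"
    if "(h has_real_derivative d) (at (x $ i))" for h d i
    by (rule DERIV_chain2[OF _ line]) (use that in simp)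
  show ?thesis
    unfolding pd_def vector_add_component vector_scaleR_component real_scaleR_def
    by (rule DERIV_imp_deriv, rule DERIV_cong, (rule DERIV_mult D assms)+) (simp add: axis_def)
qed

text \<open>Robertson-Walker geometry over a set \<open>T\<close> of times, which is open by the
  definition of \<open>smooth\<close>.\<close>

locale frw =
  fixes k :: real and a :: "real \<Rightarrow> real" and T :: "real set"
  assumes a_smooth: "smooth T a" and a_pos: "\<And>t. t \<in> T \<Longrightarrow> a t > 0"
begin

abbreviation "g \<equiv> interior_metric k a"
abbreviation "a' \<equiv> deriv a"
abbreviation "a'' \<equiv> deriv (deriv a)"

text \<open>The formula for the metric makes sense beyond the stellar surface, so no bound \<chi>
  \<le> \<open>\<chi>s\<close> is imposed: \<open>W\<close> is open and has the surface points in
  its interior.\<close>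

definition W :: "(real^4) set" where
  "W = {x. x$1 \<in> T \<and> x$2 > 0 \<and> 1 - k * (x$2)\<^sup>2 > 0 \<and> 0 < x$3 \<and> x$3 < pi}"

lemma open_W: "open W"
proof -
  have eq: "W = (\<lambda>x. x$1) -` T \<inter> {x. x$2 > 0} \<inter> {x. 0 < 1 - k * (x$2)\<^sup>2} \<inter> {x. 0 < x$3} \<inter> {x. x$3 < pi}"
    by (auto simp: W_def)
  have T: "open ((\<lambda>x::real^4. x$1) -` T)"
    using a_smooth by (intro open_vimage continuous_intros) (simp add: smooth_def)
  have k: "open {x::real^4. 0 < 1 - k * (x$2)\<^sup>2}"
    by (intro open_Collect_less continuous_intros)
  show ?thesis
    unfolding eq
    by (intro open_Int T k open_halfspace_component_gt_cart open_halfspace_component_lt_cart)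
qed

lemma W_nz:
  assumes "x \<in> W"
  shows "a (x$1) \<noteq> 0" "x$2 \<noteq> 0" "1 - k * (x$2)\<^sup>2 \<noteq> 0" "sin (x$3) \<noteq> 0"
  using assms a_pos[of "x$1"] sin_gt_zero[of "x$3"] unfolding W_def by auto

lemma ginv_W:
  assumes "x \<in> W"
  shows "ginv g x = diag4 1 (- (1 - k * (x$2)\<^sup>2) / (a (x$1))\<^sup>2) (- 1 / ((a (x$1))\<^sup>2 * (x$2)\<^sup>2))
    (- 1 / ((a (x$1))\<^sup>2 * (x$2)\<^sup>2 * (sin (x$3))\<^sup>2))"
proof -
  have "ginv g x = diag4 (inverse 1) (inverse (- (a (x$1))\<^sup>2 / (1 - k * (x$2)\<^sup>2)))
      (inverse (- (a (x$1))\<^sup>2 * (x$2)\<^sup>2)) (inverse (- (a (x$1))\<^sup>2 * (x$2)\<^sup>2 * (sin (x$3))\<^sup>2))"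
    unfolding ginv_def interior_metric_diag4 using W_nz[OF assms] by (intro matrix_inv_diag4) auto
  moreover have "inverse (- c / q) = - q / c" "inverse (- c * q) = - 1 / (c * q)"
    "inverse (- c * q * r) = - 1 / (c * q * r)" for c q r :: real
    by (simp_all add: inverse_eq_divide)
  ultimately show ?thesis by (simp only: inverse_1)
qed

lemma a_deriv:
  assumes "x \<in> W"
  shows "(a has_real_derivative a' (x$1)) (at (x$1))" "(a' has_real_derivative a'' (x$1)) (at (x$1))"
  using smooth_deriv[OF a_smooth] smooth_deriv(2)[OF smooth_deriv(1)[OF a_smooth]] assms
  by (auto simp: W_def)

lemma pd_g:
  assumes "x \<in> W"
  shows "pd \<mu> (\<lambda>z. g z $ 1 $ 1) x = 0"
    "pd \<mu> (\<lambda>z. g z $ 2 $ 2) x = (if \<mu> = 1 then - 2 * a (x$1) * a' (x$1) / (1 - k * (x$2)\<^sup>2)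
       else if \<mu> = 2 then - 2 * (a (x$1))\<^sup>2 * k * x$2 / (1 - k * (x$2)\<^sup>2)\<^sup>2 else 0)"
    "pd \<mu> (\<lambda>z. g z $ 3 $ 3) x = (if \<mu> = 1 then - 2 * a (x$1) * a' (x$1) * (x$2)\<^sup>2
       else if \<mu> = 2 then - 2 * (a (x$1))\<^sup>2 * x$2 else 0)"
    "pd \<mu> (\<lambda>z. g z $ 4 $ 4) x = (if \<mu> = 1 then - 2 * a (x$1) * a' (x$1) * (x$2)\<^sup>2 * (sin (x$3))\<^sup>2
       else if \<mu> = 2 then - 2 * (a (x$1))\<^sup>2 * x$2 * (sin (x$3))\<^sup>2
       else if \<mu> = 3 then - 2 * (a (x$1))\<^sup>2 * (x$2)\<^sup>2 * sin (x$3) * cos (x$3) else 0)"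
proof -
  note nz = W_nz[OF assms] and ad = a_deriv[OF assms]
  have A: "((\<lambda>t. - (a t)\<^sup>2) has_real_derivative - 2 * a (x$1) * a' (x$1)) (at (x$1))"
    by (auto intro!: derivative_eq_intros ad)
  have Q: "((\<lambda>r. 1 / (1 - k * r\<^sup>2)) has_real_derivative 2 * k * x$2 / (1 - k * (x$2)\<^sup>2)\<^sup>2) (at (x$2))"
    using nz by (auto intro!: derivative_eq_intros simp: power2_eq_square)
  have R: "((\<lambda>r. r\<^sup>2) has_real_derivative 2 * x$2) (at (x$2))"
    by (auto intro!: derivative_eq_intros)
  have S: "((\<lambda>r. (sin r)\<^sup>2) has_real_derivative 2 * sin (x$3) * cos (x$3)) (at (x$3))"
    by (auto intro!: derivative_eq_intros)
  show "pd \<mu> (\<lambda>z. g z $ 1 $ 1) x = 0"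
    by (simp add: interior_metric_diag4 diag4_nth pd_def)
  show "pd \<mu> (\<lambda>z. g z $ 2 $ 2) x = (if \<mu> = 1 then - 2 * a (x$1) * a' (x$1) / (1 - k * (x$2)\<^sup>2)
       else if \<mu> = 2 then - 2 * (a (x$1))\<^sup>2 * k * x$2 / (1 - k * (x$2)\<^sup>2)\<^sup>2 else 0)"
    using pd_prod[OF A Q DERIV_const[of 1], of \<mu>] by (simp add: interior_metric_diag4 diag4_nth mult_ac)
  show "pd \<mu> (\<lambda>z. g z $ 3 $ 3) x = (if \<mu> = 1 then - 2 * a (x$1) * a' (x$1) * (x$2)\<^sup>2
       else if \<mu> = 2 then - 2 * (a (x$1))\<^sup>2 * x$2 else 0)"
    using pd_prod[OF A R DERIV_const[of 1], of \<mu>] by (simp add: interior_metric_diag4 diag4_nth mult_ac)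
  show "pd \<mu> (\<lambda>z. g z $ 4 $ 4) x = (if \<mu> = 1 then - 2 * a (x$1) * a' (x$1) * (x$2)\<^sup>2 * (sin (x$3))\<^sup>2
       else if \<mu> = 2 then - 2 * (a (x$1))\<^sup>2 * x$2 * (sin (x$3))\<^sup>2
       else if \<mu> = 3 then - 2 * (a (x$1))\<^sup>2 * (x$2)\<^sup>2 * sin (x$3) * cos (x$3) else 0)"
    using pd_prod[OF A R S, of \<mu>] by (simp add: interior_metric_diag4 diag4_nth mult_ac)
qed

lemma christoffel_Gamma:
  assumes "x \<in> W"
  shows "christoffel g \<rho> \<mu> \<nu> x = 1/2 * ginv g x $ \<rho> $ \<rho> *
    ((if \<rho> = \<nu> then pd \<mu> (\<lambda>z. g z $ \<rho> $ \<rho>) x else 0)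
     + (if \<rho> = \<mu> then pd \<nu> (\<lambda>z. g z $ \<rho> $ \<rho>) x else 0)
     - (if \<mu> = \<nu> then pd \<rho> (\<lambda>z. g z $ \<mu> $ \<mu>) x else 0))"
  by (rule christoffel_diag)
    (simp_all only: ginv_W[OF assms] interior_metric_diag4 diag4_nth(5) not_False_eq_True)

text \<open>The factors \<open>1\<close> bring every right-hand side into the form \<open>p(t) q(r) w(\<theta>)\<close> of \<open>pd_prod\<close>.\<close>

lemma Gamma_W:
  assumes "x \<in> W"
  shows
    "christoffel g 1 2 2 x = (a (x$1) * a' (x$1)) * (1 / (1 - k * (x$2)\<^sup>2)) * 1"
    "christoffel g 1 3 3 x = (a (x$1) * a' (x$1)) * (x$2)\<^sup>2 * 1"
    "christoffel g 1 4 4 x = (a (x$1) * a' (x$1)) * (x$2)\<^sup>2 * (sin (x$3))\<^sup>2"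
    "christoffel g 2 2 2 x = 1 * (k * x$2 / (1 - k * (x$2)\<^sup>2)) * 1"
    "christoffel g 2 3 3 x = 1 * (- x$2 * (1 - k * (x$2)\<^sup>2)) * 1"
    "christoffel g 2 4 4 x = 1 * (- x$2 * (1 - k * (x$2)\<^sup>2)) * (sin (x$3))\<^sup>2"
    "christoffel g 3 4 4 x = 1 * 1 * (- sin (x$3) * cos (x$3))"
    "christoffel g 2 1 2 x = (a' (x$1) / a (x$1)) * 1 * 1"
    "christoffel g 2 2 1 x = (a' (x$1) / a (x$1)) * 1 * 1"
    "christoffel g 3 1 3 x = (a' (x$1) / a (x$1)) * 1 * 1"
    "christoffel g 3 3 1 x = (a' (x$1) / a (x$1)) * 1 * 1"
    "christoffel g 4 1 4 x = (a' (x$1) / a (x$1)) * 1 * 1"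
    "christoffel g 4 4 1 x = (a' (x$1) / a (x$1)) * 1 * 1"
    "christoffel g 3 2 3 x = 1 * (1 / x$2) * 1"
    "christoffel g 3 3 2 x = 1 * (1 / x$2) * 1"
    "christoffel g 4 2 4 x = 1 * (1 / x$2) * 1"
    "christoffel g 4 4 2 x = 1 * (1 / x$2) * 1"
    "christoffel g 4 3 4 x = 1 * 1 * (cos (x$3) / sin (x$3))"
    "christoffel g 4 4 3 x = 1 * 1 * (cos (x$3) / sin (x$3))"
    "christoffel g 1 1 \<nu> x = 0" "christoffel g 1 \<nu> 1 x = 0"
    "christoffel g 2 1 1 x = 0" "christoffel g 3 1 1 x = 0" "christoffel g 4 1 1 x = 0"
    "christoffel g 3 2 2 x = 0" "christoffel g 4 2 2 x = 0"
    "christoffel g 3 3 3 x = 0" "christoffel g 4 3 3 x = 0" "christoffel g 4 4 4 x = 0"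
    "\<rho> \<noteq> \<mu> \<Longrightarrow> \<rho> \<noteq> \<nu> \<Longrightarrow> \<mu> \<noteq> \<nu> \<Longrightarrow> christoffel g \<rho> \<mu> \<nu> x = 0"
    "christoffel g 2 2 3 x = 0" "christoffel g 2 2 4 x = 0" "christoffel g 3 3 4 x = 0"
    "christoffel g 2 3 2 x = 0" "christoffel g 2 4 2 x = 0" "christoffel g 3 4 3 x = 0"
proof -
  note G = christoffel_Gamma[OF assms]
  show "\<rho> \<noteq> \<mu> \<Longrightarrow> \<rho> \<noteq> \<nu> \<Longrightarrow> \<mu> \<noteq> \<nu> \<Longrightarrow> christoffel g \<rho> \<mu> \<nu> x = 0"
    by (simp add: G)
  show "christoffel g 2 2 2 x = 1 * (k * x$2 / (1 - k * (x$2)\<^sup>2)) * 1"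
  proof -
    \<comment> \<open>With 1 - k \<chi>^2 abstracted to \<open>Q\<close>, the claim is a mere
      cancellation of \<open>Q\<close> and \<open>c\<close>.\<close>
    have "1/2 * (- Q / c) * (- 2 * c * k * x$2 / Q\<^sup>2) = k * x$2 / Q" if "Q \<noteq> 0" "c \<noteq> 0" for Q c
      using that by (simp add: power2_eq_square)
    from this[of "1 - k * (x$2)\<^sup>2" "(a (x$1))\<^sup>2"] show ?thesis
      using W_nz[OF assms] by (simp add: G pd_g[OF assms] ginv_W[OF assms] diag4_nth neq4)
  qed
  have "christoffel g 1 1 \<nu> x = 0 \<and> christoffel g 1 \<nu> 1 x = 0" for \<nu>
    using exhaust_4[of \<nu>] by (auto simp: G pd_g[OF assms] neq4)
  then show "christoffel g 1 1 \<nu> x = 0" "christoffel g 1 \<nu> 1 x = 0" by blast+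
qed (use W_nz[OF assms] in \<open>simp_all add: christoffel_Gamma[OF assms] pd_g[OF assms] ginv_W[OF assms]
    diag4_nth neq4 power2_eq_square field_simps\<close>)

lemma pd_Gamma_W:
  assumes "x \<in> W"
    and "\<And>z. z \<in> W \<Longrightarrow> christoffel g \<alpha> \<beta> \<gamma> z = p (z$1) * q (z$2) * w (z$3)"
    and "(p has_real_derivative p') (at (x$1))" "(q has_real_derivative q') (at (x$2))"
    and "(w has_real_derivative w') (at (x$3))"
  shows "pd \<mu> (christoffel g \<alpha> \<beta> \<gamma>) x =
    (if \<mu> = 1 then p' * q (x$2) * w (x$3)
     else if \<mu> = 2 then p (x$1) * q' * w (x$3)
     else if \<mu> = 3 then p (x$1) * q (x$2) * w' else 0)"
  using pd_cong_open[where \<mu> = \<mu>, OF open_W assms(1,2)] pd_prod[OF assms(3-5), of \<mu>] by simp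

lemma pd_Gamma_zero:
  assumes "x \<in> W" "\<And>z. z \<in> W \<Longrightarrow> christoffel g \<alpha> \<beta> \<gamma> z = 0"
  shows "pd \<mu> (christoffel g \<alpha> \<beta> \<gamma>) x = 0"
  using pd_cong_open[OF open_W assms(1), of "christoffel g \<alpha> \<beta> \<gamma>" "\<lambda>z. 0" \<mu>] assms(2)
  by (simp add: pd_def)

text \<open>These are derivatives that occur in the diagonal Ricci components; that of \<Gamma>^2_22
  cancels there. The value 2 - 3 Q stands for -1 + 3 k \<chi>^2, so that everything is expressed
  through \<open>Q\<close>.\<close>

lemma pd_Gammas:
  assumes "x \<in> W"
  defines "Q \<equiv> 1 - k * (x$2)\<^sup>2"
  shows
    "pd 1 (christoffel g 1 2 2) x = ((a' (x$1))\<^sup>2 + a (x$1) * a'' (x$1)) / Q"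
    "pd 1 (christoffel g 1 3 3) x = ((a' (x$1))\<^sup>2 + a (x$1) * a'' (x$1)) * (x$2)\<^sup>2"
    "pd 1 (christoffel g 1 4 4) x = ((a' (x$1))\<^sup>2 + a (x$1) * a'' (x$1)) * (x$2)\<^sup>2 * (sin (x$3))\<^sup>2"
    "pd 2 (christoffel g 2 3 3) x = 2 - 3 * Q"
    "pd 2 (christoffel g 2 4 4) x = (2 - 3 * Q) * (sin (x$3))\<^sup>2"
    "pd 3 (christoffel g 3 4 4) x = (sin (x$3))\<^sup>2 - (cos (x$3))\<^sup>2"
    "\<alpha> \<in> {2, 3, 4} \<Longrightarrow> pd 1 (christoffel g \<alpha> 1 \<alpha>) x = a'' (x$1) / a (x$1) - (a' (x$1) / a (x$1))\<^sup>2"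
    "\<alpha> \<in> {3, 4} \<Longrightarrow> pd 2 (christoffel g \<alpha> 2 \<alpha>) x = - 1 / (x$2)\<^sup>2"
    "pd 3 (christoffel g 4 3 4) x = - 1 - (cos (x$3) / sin (x$3))\<^sup>2"
    "pd 4 (christoffel g \<alpha> 4 \<alpha>) x = 0"
proof -
  note nz = W_nz[OF assms(1)] and ad = a_deriv[OF assms(1)]
  note pdG = pd_Gamma_W[OF assms(1)] and c = DERIV_const[of 1]
  have A: "((\<lambda>t. a t * a' t) has_real_derivative (a' (x$1))\<^sup>2 + a (x$1) * a'' (x$1)) (at (x$1))"
    by (auto intro!: derivative_eq_intros ad simp: power2_eq_square)
  have H: "((\<lambda>t. a' t / a t) has_real_derivative a'' (x$1) / a (x$1) - (a' (x$1) / a (x$1))\<^sup>2) (at (x$1))"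
    using nz by (auto intro!: derivative_eq_intros ad simp: power2_eq_square diff_divide_distrib)
  have Q': "((\<lambda>r. 1 / (1 - k * r\<^sup>2)) has_real_derivative 2 * k * x$2 / Q\<^sup>2) (at (x$2))"
    using nz by (auto intro!: derivative_eq_intros simp: power2_eq_square Q_def)
  have R: "((\<lambda>r. r\<^sup>2) has_real_derivative 2 * x$2) (at (x$2))"
    by (auto intro!: derivative_eq_intros)
  have RQ: "((\<lambda>r. - r * (1 - k * r\<^sup>2)) has_real_derivative 2 - 3 * Q) (at (x$2))"
    by (auto intro!: derivative_eq_intros simp: Q_def algebra_simps power2_eq_square)
  have I: "((\<lambda>r. 1 / r) has_real_derivative - 1 / (x$2)\<^sup>2) (at (x$2))"
    using nz by (auto intro!: derivative_eq_intros simp: power2_eq_square)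
  have S: "((\<lambda>r. (sin r)\<^sup>2) has_real_derivative 2 * sin (x$3) * cos (x$3)) (at (x$3))"
    by (auto intro!: derivative_eq_intros)
  have SC: "((\<lambda>r. - sin r * cos r) has_real_derivative (sin (x$3))\<^sup>2 - (cos (x$3))\<^sup>2) (at (x$3))"
    by (auto intro!: derivative_eq_intros simp: power2_eq_square)
  have C: "((\<lambda>r. cos r / sin r) has_real_derivative - 1 - (cos (x$3) / sin (x$3))\<^sup>2) (at (x$3))"
    using nz by (auto intro!: derivative_eq_intros simp: power2_eq_square diff_divide_distrib)
  show "pd 1 (christoffel g 1 2 2) x = ((a' (x$1))\<^sup>2 + a (x$1) * a'' (x$1)) / Q"
    using pdG[OF Gamma_W(1) A Q' c, of 1] by (simp add: Q_def)
  show "pd 1 (christoffel g 1 3 3) x = ((a' (x$1))\<^sup>2 + a (x$1) * a'' (x$1)) * (x$2)\<^sup>2"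
    using pdG[OF Gamma_W(2) A R c, of 1] by simp
  show "pd 1 (christoffel g 1 4 4) x = ((a' (x$1))\<^sup>2 + a (x$1) * a'' (x$1)) * (x$2)\<^sup>2 * (sin (x$3))\<^sup>2"
    using pdG[OF Gamma_W(3) A R S, of 1] by simp
  show "pd 2 (christoffel g 2 3 3) x = 2 - 3 * Q"
    using pdG[OF Gamma_W(5) c RQ c, of 2] by simp
  show "pd 2 (christoffel g 2 4 4) x = (2 - 3 * Q) * (sin (x$3))\<^sup>2"
    using pdG[OF Gamma_W(6) c RQ S, of 2] by simp
  show "pd 3 (christoffel g 3 4 4) x = (sin (x$3))\<^sup>2 - (cos (x$3))\<^sup>2"
    using pdG[OF Gamma_W(7) c c SC, of 3] by simp
  show "\<alpha> \<in> {2, 3, 4} \<Longrightarrow> pd 1 (christoffel g \<alpha> 1 \<alpha>) x = a'' (x$1) / a (x$1) - (a' (x$1) / a (x$1))\<^sup>2"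
    using pdG[OF Gamma_W(8) H c c, of 1] pdG[OF Gamma_W(10) H c c, of 1]
      pdG[OF Gamma_W(12) H c c, of 1] by auto
  show "\<alpha> \<in> {3, 4} \<Longrightarrow> pd 2 (christoffel g \<alpha> 2 \<alpha>) x = - 1 / (x$2)\<^sup>2"
    using pdG[OF Gamma_W(14) c I c, of 2] pdG[OF Gamma_W(16) c I c, of 2] by auto
  show "pd 3 (christoffel g 4 3 4) x = - 1 - (cos (x$3) / sin (x$3))\<^sup>2"
    using pdG[OF Gamma_W(18) c c C, of 3] by simp
  show "pd 4 (christoffel g \<alpha> 4 \<alpha>) x = 0"
    using exhaust_4[of \<alpha>] pdG[OF Gamma_W(13) H c c, of 4] pdG[OF Gamma_W(17) c I c, of 4]
    by (auto intro!: pd_Gamma_zero[OF assms(1)] simp: Gamma_W)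
qed

text \<open>Isotropy is visible in the result: the spatial components are h / a^2 times those of the
  metric. The signs follow the convention of \<open>riemann\<close>.\<close>

lemma ricci_diag:
  assumes "x \<in> W"
  defines "Q \<equiv> 1 - k * (x$2)\<^sup>2"
  defines "h \<equiv> a (x$1) * a'' (x$1) + 2 * (a' (x$1))\<^sup>2 + 2 * k"
  shows "ricci g 1 1 x = 3 * a'' (x$1) / a (x$1)"
    and "ricci g 2 2 x = - h / Q"
    and "ricci g 3 3 x = - h * (x$2)\<^sup>2"
    and "ricci g 4 4 x = - h * (x$2)\<^sup>2 * (sin (x$3))\<^sup>2"
proof -
  note nz = W_nz[OF assms(1), folded Q_def]
  have zero: "(\<And>z. z \<in> W \<Longrightarrow> christoffel g \<alpha> \<beta> \<gamma> z = 0) \<Longrightarrow> pd \<mu> (christoffel g \<alpha> \<beta> \<gamma>) x = 0"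
    for \<mu> \<alpha> \<beta> \<gamma> by (rule pd_Gamma_zero[OF assms(1)])
  \<comment> \<open>\<open>Gamma_W(20-)\<close> is added without fixing the point because the
    premise of \<open>zero\<close> asks for vanishing on all of \<open>W\<close>.\<close>
  note [simp] = zero Gamma_W[OF assms(1), folded Q_def] pd_Gammas[OF assms(1), folded Q_def] neq4
    Gamma_W(20-)
  \<comment> \<open>Eliminating the cosine leaves polynomial identities in independent
    quantities.\<close>
  have cos2: "(cos (x$3))\<^sup>2 = 1 - (sin (x$3))\<^sup>2" by (simp add: cos_squared_eq)
  then have cos2': "cos (x$3) * cos (x$3) = 1 - sin (x$3) * sin (x$3)"
    by (simp add: power2_eq_square)
  show "ricci g 1 1 x = 3 * a'' (x$1) / a (x$1)"
    unfolding ricci_def riemann_def sum_4 by (simp add: power2_eq_square)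
  show "ricci g 2 2 x = - h / Q"
    unfolding ricci_def riemann_def sum_4 h_def
    by (simp add: nz power2_eq_square add_divide_distrib diff_divide_distrib)
  show "ricci g 3 3 x = - h * (x$2)\<^sup>2"
    unfolding ricci_def riemann_def sum_4 h_def
    by (simp add: nz power2_eq_square, simp add: Q_def power2_eq_square algebra_simps)
  show "ricci g 4 4 x = - h * (x$2)\<^sup>2 * (sin (x$3))\<^sup>2"
    unfolding ricci_def riemann_def sum_4 h_def
    by (simp add: nz cos2, simp add: Q_def cos2' power2_eq_square algebra_simps)
qed

lemma ricci_scalar_trace:
  assumes "x \<in> W"
  shows "ricci_scalar g x = (\<Sum>\<mu>\<in>UNIV. ginv g x $ \<mu> $ \<mu> * ricci g \<mu> \<mu> x)"
  unfolding ricci_scalar_def sum_4 by (simp add: ginv_W[OF assms] diag4_nth neq4)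

lemma ricci_scalar_W:
  assumes "x \<in> W"
  shows "ricci_scalar g x = 6 * (((a' (x$1))\<^sup>2 + k) / (a (x$1))\<^sup>2 + a'' (x$1) / a (x$1))"
proof -
  \<comment> \<open>Each of the three spatial directions contributes h / A^2 to the trace.\<close>
  have *: "3 * a2 / A + (- Q / A\<^sup>2) * (- h / Q) + (- 1 / (A\<^sup>2 * r\<^sup>2)) * (- h * r\<^sup>2)
        + (- 1 / (A\<^sup>2 * r\<^sup>2 * s\<^sup>2)) * (- h * r\<^sup>2 * s\<^sup>2) = 6 * ((a1\<^sup>2 + k) / A\<^sup>2 + a2 / A)"
    (is "?lhs = _")
    if "Q \<noteq> 0" "A \<noteq> 0" "r \<noteq> 0" "s \<noteq> 0" "h = A * a2 + 2 * a1\<^sup>2 + 2 * k" for Q A r s h a1 a2 :: real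
  proof -
    have "?lhs = 3 * a2 / A + 3 * h / A\<^sup>2" using that(1-4) by simp
    also have "\<dots> = 6 * ((a1\<^sup>2 + k) / A\<^sup>2 + a2 / A)"
      using that(2) by (simp add: that(5) power2_eq_square add_divide_distrib)
    finally show ?thesis .
  qed
  show ?thesis
    unfolding ricci_scalar_trace[OF assms] sum_4 ginv_W[OF assms] diag4_nth ricci_diag[OF assms] mult_1
    by (rule *) (use W_nz[OF assms] in simp_all)
qed

text \<open>Constant curvature on the open set \<open>W\<close> makes f'(R) constant there, so its
  first and second derivatives vanish at \<open>x\<close>. Contracting what remains with the inverse
  metric turns the metric into 4 and the dust stress into \<rho>.\<close>

lemma field_eqs_trace:
  assumes x: "x \<in> W" and R: "\<And>z. z \<in> W \<Longrightarrow> ricci_scalar g z = c"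
    and eqs: "fR_field_eqs f \<kappa> g (dust_stress g \<rho> (\<lambda>z. axis 1 1)) x"
  shows "deriv f c * c - 2 * f c = - \<kappa> * \<rho> x"
proof -
  let ?\<phi> = "\<lambda>z. deriv f (ricci_scalar g z)"
  have pd: "pd \<nu> ?\<phi> z = 0" if "z \<in> W" for \<nu> z
    using pd_cong_open[OF open_W that, of ?\<phi> "\<lambda>z. deriv f c"] by (simp add: R pd_def)
  have "pd \<mu> (pd \<nu> ?\<phi>) x = 0" for \<mu> \<nu>
    using pd_cong_open[OF open_W x, of "pd \<nu> ?\<phi>" "\<lambda>z. 0" \<mu>] pd by (simp add: pd_def)
  then have hess: "hessian g ?\<phi> \<mu> \<nu> x = 0" for \<mu> \<nu>
    by (simp add: hessian_def pd[OF x])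
  have "g x *v axis 1 1 = vector [1, 0, 0, 0]"
    by (simp add: interior_metric_diag4 diag4_mv axis_def)
  then have T: "dust_stress g \<rho> (\<lambda>z. axis 1 1) x $ \<mu> $ \<mu> = (if \<mu> = 1 then \<rho> x else 0)" for \<mu>
    using exhaust_4[of \<mu>] by (auto simp: dust_stress_def vector4_nth)
  have diag: "deriv f c * ricci g \<mu> \<mu> x - 1/2 * f c * g x $ \<mu> $ \<mu> = - \<kappa> * (if \<mu> = 1 then \<rho> x else 0)" for \<mu>
    using eqs[unfolded fR_field_eqs_def Let_def, rule_format, of \<mu> \<mu>]
    by (simp only: R[OF x] hess dalembertian_def T) simp
  have inv: "ginv g x $ \<mu> $ \<mu> * g x $ \<mu> $ \<mu> = 1" for \<mu>
    using exhaust_4[of \<mu>] W_nz[OF x]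
    by (auto simp: ginv_W[OF x] interior_metric_diag4 diag4_nth divide_eq_minus_1_iff)
  have "(\<Sum>\<mu>\<in>UNIV. ginv g x $ \<mu> $ \<mu> * (deriv f c * ricci g \<mu> \<mu> x - 1/2 * f c * g x $ \<mu> $ \<mu>))
      = deriv f c * (\<Sum>\<mu>\<in>UNIV. ginv g x $ \<mu> $ \<mu> * ricci g \<mu> \<mu> x)
        - 1/2 * f c * (\<Sum>\<mu>\<in>UNIV. ginv g x $ \<mu> $ \<mu> * g x $ \<mu> $ \<mu>)"
    by (simp add: sum_4 algebra_simps)
  also have "\<dots> = deriv f c * c - 2 * f c"
    using R[OF x] by (simp add: inv ricci_scalar_trace[OF x, symmetric])
  finally show ?thesis
    unfolding diag by (simp add: sum_4 neq4 ginv_W[OF x] diag4_nth)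
qed

end

section \<open>The matching surface\<close>

lemma pd_component:
  assumes "(h has_real_derivative d) (at (x $ i))"
  shows "pd \<mu> (\<lambda>z. h (z $ i)) x = d * axis \<mu> 1 $ i"
proof -
  have line: "((\<lambda>s. x $ i + s * axis \<mu> 1 $ i) has_real_derivative axis \<mu> 1 $ i) (at 0)"
    by (auto intro!: derivative_eq_intros)
  show ?thesis
    unfolding pd_def vector_add_component vector_scaleR_component real_scaleR_def
    by (intro DERIV_imp_deriv DERIV_chain2[OF _ line]) (use assms in simp)
qed

text \<open>In comoving coordinates the surface is the case of identical time and constant radius,
  so one computation of tangent vectors serves both sides.\<close>

lemma interior_embedding_eq: "interior_embedding r = exterior_embedding (\<lambda>t. t) (\<lambda>t. r)"
  by (simp add: fun_eq_iff interior_embedding_def exterior_embedding_def)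

lemma tangent_exterior_embedding:
  assumes "(ts has_real_derivative t') (at (y$1))" "(rs has_real_derivative r') (at (y$1))"
  defines "X \<equiv> exterior_embedding ts rs"
  shows "tangent X 1 y = vector [t', r', 0, 0]"
    "tangent X 2 y = vector [0, 0, 1, 0]" "tangent X 3 y = vector [0, 0, 0, 1]"
proof -
  have "pd i (\<lambda>w. X w $ 1) y = t' * axis i 1 $ 1" "pd i (\<lambda>w. X w $ 2) y = r' * axis i 1 $ 1"
    "pd i (\<lambda>w. X w $ 3) y = 1 * axis i 1 $ 2" "pd i (\<lambda>w. X w $ 4) y = 1 * axis i 1 $ 3" for i
    unfolding X_def exterior_embedding_def vector4_nth
    by (intro pd_component assms DERIV_ident)+
  then show "tangent X 1 y = vector [t', r', 0, 0]"
    "tangent X 2 y = vector [0, 0, 1, 0]" "tangent X 3 y = vector [0, 0, 0, 1]"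
    by (simp_all add: tangent_def vec_eq_iff forall_4 vector4_nth axis_def)
qed

lemma inner4: "x \<bullet> y = x$1 * y$1 + x$2 * y$2 + x$3 * y$3 + x$4 * y$4" for x y :: "real^4"
  by (simp add: inner_vec_def sum_4)

text \<open>Orthogonality kills the angular components and fixes the ratio of the other two. The
  length condition, combined with the unit length of the first tangent vector, gives q (n^r)^2 = p
  u^2, and n^r > 0 selects the root.\<close>

lemma unit_normal_diag4:
  assumes g: "g (X y) = diag4 p (- q) r s"
    and tan: "tangent X 1 y = vector [u, v, 0, 0]" "tangent X 2 y = vector [0, 0, 1, 0]"
      "tangent X 3 y = vector [0, 0, 0, 1]"
    and pos: "p > 0" "q > 0" "r \<noteq> 0" "s \<noteq> 0" "u > 0" and unit: "p * u\<^sup>2 - q * v\<^sup>2 = 1"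
  shows "unit_normal g X y = vector [sqrt (q / p) * v, sqrt (p / q) * u, 0, 0]"
proof -
  let ?N = "vector [sqrt (q / p) * v, sqrt (p / q) * u, 0, 0] :: real^4"
  have iff: "((\<forall>a. n \<bullet> (g (X y) *v tangent X a y) = 0) \<and> n \<bullet> (g (X y) *v n) = - 1 \<and> n $ 2 > 0) \<longleftrightarrow>
      (p * u * n$1 = q * v * n$2 \<and> n$3 = 0 \<and> n$4 = 0) \<and> p * (n$1)\<^sup>2 - q * (n$2)\<^sup>2 = - 1 \<and> n$2 > 0"
    for n
    using pos by (auto simp: g tan diag4_mv inner4 forall_3 vector4_nth power2_eq_square algebra_simps)
  have sq: "sqrt p * sqrt p = p" "sqrt q * sqrt q = q" "sqrt p > 0" "sqrt q > 0"
    using pos by simp_all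
  \<comment> \<open>In terms of the roots of \<open>p\<close> and \<open>q\<close> the claimed
    normal is a rational expression.\<close>
  define P Q where "P = sqrt p" and "Q = sqrt q"
  have PQ: "p = P * P" "q = Q * Q" "P > 0" "Q > 0" using sq by (simp_all add: P_def Q_def)
  have s: "sqrt (q / p) = Q / P" "sqrt (p / q) = P / Q"
    by (simp_all add: real_sqrt_divide P_def Q_def)
  show ?thesis
    unfolding unit_normal_def iff
  proof (rule the_equality)
    have "P * P * u * (Q / P * v) = Q * Q * v * (P / Q * u)" using PQ by simp
    moreover have "P * P * (Q / P * v)\<^sup>2 - Q * Q * (P / Q * u)\<^sup>2 = - (P * P * u\<^sup>2 - Q * Q * v\<^sup>2)"
      using PQ(3,4) by (simp add: power2_eq_square)
    ultimately show "(p * u * ?N$1 = q * v * ?N$2 \<and> ?N$3 = 0 \<and> ?N$4 = 0) \<and>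
        p * (?N$1)\<^sup>2 - q * (?N$2)\<^sup>2 = - 1 \<and> ?N$2 > 0"
      using unit pos(5) PQ(3,4) unfolding vector4_nth s unfolding PQ(1,2) by simp
  next
    fix n :: "real^4"
    assume n: "(p * u * n$1 = q * v * n$2 \<and> n$3 = 0 \<and> n$4 = 0) \<and>
        p * (n$1)\<^sup>2 - q * (n$2)\<^sup>2 = - 1 \<and> n$2 > 0"
    have n1: "n$1 = q * v * n$2 / (p * u)" using n pos by (simp add: field_simps)
    \<comment> \<open>The factor (p u)^2 allows the orthogonality relation to eliminate the first
      component of \<open>n\<close> without division.\<close>
    have "(p * u)\<^sup>2 * (p * (n$1)\<^sup>2 - q * (n$2)\<^sup>2) = p * (p * u * n$1)\<^sup>2 - q * (p * u * n$2)\<^sup>2"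
      by (simp add: power2_eq_square algebra_simps)
    also have "\<dots> = - (q * (n$2)\<^sup>2 * p * (p * u\<^sup>2 - q * v\<^sup>2))"
      using n by (simp add: power2_eq_square algebra_simps)
    finally have E: "(p * u)\<^sup>2 * (p * (n$1)\<^sup>2 - q * (n$2)\<^sup>2) = - (q * (n$2)\<^sup>2 * p * (p * u\<^sup>2 - q * v\<^sup>2))" .
    have "p * (n$1)\<^sup>2 - q * (n$2)\<^sup>2 = - 1" using n by blast
    from E[unfolded this unit] have "p * (p * u\<^sup>2) = p * (q * (n$2)\<^sup>2)"
      by (simp add: power2_eq_square algebra_simps)
    then have "q * (n$2)\<^sup>2 = p * u\<^sup>2" using pos by simp
    then have "(Q * n$2)\<^sup>2 = (P * u)\<^sup>2" by (simp add: PQ(1,2) power2_eq_square mult_ac)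
    then have "Q * n$2 = P * u"
      using n pos PQ(3,4) by (simp add: power2_eq_iff_nonneg)
    then have n2: "n$2 = P / Q * u" using PQ by (simp add: field_simps)
    then have "n$1 = Q / P * v" using PQ(3,4) pos(5) unfolding n1 PQ(1,2) by simp
    with n n2 show "n = ?N"
      by (simp add: vec_eq_iff forall_4 vector4_nth s)
  qed
qed

section \<open>One-sided derivatives\<close>

text \<open>A two-sided derivative is also the limit of difference quotients within
  \<open>S\<close>. Agreement at \<open>x\<close> itself makes the quotients of the two functions
  coincide.\<close>

lemma has_real_derivative_unique_one_sided:
  fixes f h :: "real \<Rightarrow> real"
  assumes "(f has_real_derivative D) (at x)" "(h has_real_derivative D') (at x)" "f x = h x"
    and "eventually (\<lambda>y. f y = h y) (at x within S)" "at x within S \<noteq> bot"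
  shows "D = D'"
proof -
  have f: "((\<lambda>y. (f y - f x) / (y - x)) \<longlongrightarrow> D) (at x within S)"
    and h: "((\<lambda>y. (h y - h x) / (y - x)) \<longlongrightarrow> D') (at x within S)"
    using assms(1,2) has_field_derivative_at_within[of _ _ x S] by (simp_all add: has_field_derivative_iff)
  have "\<forall>\<^sub>F y in at x within S. (h y - h x) / (y - x) = (f y - f x) / (y - x)"
    using assms(4) by eventually_elim (simp add: assms(3))
  from tendsto_unique[OF assms(5) f Lim_transform_eventually[OF h this]] show ?thesis .
qed

theorem mainTheorem6:
  fixes f :: "real \<Rightarrow> real" and I :: "real set"
    and \<kappa> k \<rho>0 \<chi>s \<tau>c :: real and a :: "real \<Rightarrow> real"
    and E :: "(real \<times> real) set" and A B :: "real \<times> real \<Rightarrow> real"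
  assumes "is_interval I" and "smooth_on I f"
    and nonlinear: "\<forall>R\<in>I. deriv (deriv f) R \<noteq> 0"
    and "\<kappa> > 0"
    and interior: "collapsing_dust_star f I \<kappa> k \<rho>0 \<chi>s \<tau>c a"
    and exterior: "vacuum_exterior f I \<kappa> E A B"
    and R_of_t_or_r:
      "(\<exists>F::real \<Rightarrow> real. \<forall>x\<in>exterior_region E. ricci_scalar (exterior_metric A B) x = F (x$1)) \<or>
       (\<exists>F::real \<Rightarrow> real. \<forall>x\<in>exterior_region E. ricci_scalar (exterior_metric A B) x = F (x$2))"
  shows "\<not> smoothly_matched k a \<tau>c \<chi>s E A B"
proof

  \<comment> \<open>Interior and surface data on the open interval of collapse\<close>
  assume match: "smoothly_matched k a \<tau>c \<chi>s E A B"
  \<comment> \<open>The instant \<tau> = 0 is left out because \<open>a\<close> has zero derivative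
    there: the surface is at rest and the time component of its exterior normal vanishes.\<close>
  define T where "T = {0<..<\<tau>c}"
  have star: "\<rho>0 > 0" "\<chi>s > 0" "1 - k * \<chi>s\<^sup>2 > 0" "\<tau>c > 0" "smooth_on {0..<\<tau>c} a"
      "\<And>\<tau>. \<tau> \<in> T \<Longrightarrow> a \<tau> > 0" "\<And>\<tau>. \<tau> \<in> T \<Longrightarrow> deriv a \<tau> < 0"
    and eqs: "\<And>x. x \<in> interior_region \<tau>c \<chi>s \<Longrightarrow> fR_field_eqs f \<kappa> (interior_metric k a)
          (dust_stress (interior_metric k a) (\<lambda>z. \<rho>0 / (a (z$1))^3) (\<lambda>z. axis 1 1)) x"
    using interior by (auto simp: collapsing_dust_star_def T_def)
  obtain ts rs where ts: "smooth_on {0..<\<tau>c} ts" and rs: "smooth_on {0..<\<tau>c} rs"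
    and ts_pos: "\<And>\<tau>. \<tau> \<in> T \<Longrightarrow> deriv ts \<tau> > 0"
    and nbhd: "\<And>\<tau>. \<tau> \<in> T \<Longrightarrow> \<exists>\<epsilon>>0. \<forall>\<tau>'\<in>{0..<\<tau>c}. \<forall>r.
            \<bar>\<tau>' - \<tau>\<bar> < \<epsilon> \<and> rs \<tau>' \<le> r \<and> r < rs \<tau>' + \<epsilon> \<longrightarrow> (ts \<tau>', r) \<in> E"
    and junction: "\<And>y. y$1 \<in> T \<Longrightarrow> 0 < y$2 \<Longrightarrow> y$2 < pi \<Longrightarrow>
            junction_conditions (interior_metric k a) (interior_embedding \<chi>s)
              (exterior_metric A B) (exterior_embedding ts rs) y"
    using match unfolding smoothly_matched_def T_def
    by (auto simp: greaterThanLessThan_iff atLeastLessThan_iff)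

  have smooth_T: "smooth T h" if "smooth_on {0..<\<tau>c} h" for h
  proof -
    obtain U where "{0..<\<tau>c} \<subseteq> U" "\<And>n. Ck_on n U h" using \<open>smooth_on _ h\<close> unfolding smooth_on_def by blast
    moreover have "T \<subseteq> {0..<\<tau>c}" "open T" by (auto simp: T_def)
    ultimately show ?thesis by (auto simp: smooth_def intro: Ck_on_subset[of _ U])
  qed
  interpret frw k a T
    by unfold_locales (use smooth_T star in auto)
  note a_D = smooth_deriv(2)[OF a_smooth] and ts_D = smooth_deriv(2)[OF smooth_T[OF ts]]
    and rs_D = smooth_deriv(2)[OF smooth_T[OF rs]]
  have a_decreasing: "a u < a t" if "t \<in> T" "u \<in> T" "t < u" for t u
  proof (rule DERIV_neg_imp_decreasing[OF that(3)])
    fix s assume "t \<le> s" "s \<le> u"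
    then have "s \<in> T" using that by (simp add: T_def)
    then show "\<exists>d. (a has_real_derivative d) (at s) \<and> d < 0" using a_D star(7) by blast
  qed

  \<comment> \<open>The junction conditions are evaluated along a single curve of the surface, on
    the equator, away from the coordinate axis.\<close>
  define y where "y \<tau> = (vector [\<tau>, pi / 2, 0] :: real^3)" for \<tau>
  have y: "y \<tau> $ 1 = \<tau>" "y \<tau> $ 2 = pi / 2" "y \<tau> $ 3 = 0" for \<tau> by (simp_all add: y_def)
  let ?gp = "exterior_metric A B" and ?Xp = "exterior_embedding ts rs"
  let ?Xm = "interior_embedding \<chi>s"
  have J: "junction_conditions g ?Xm ?gp ?Xp (y \<tau>)" if "\<tau> \<in> T" for \<tau>
    using junction[of "y \<tau>"] that by (simp add: y)
  define P where "P t r = (vector [t, r, pi / 2, 0] :: real^4)" for t r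
  have P: "P t r $ 1 = t" "P t r $ 2 = r" "P t r $ 3 = pi / 2" for t r
    by (simp_all add: P_def vector4_nth)
  have X: "?Xp (y \<tau>) = P (ts \<tau>) (rs \<tau>)" "?Xm (y \<tau>) = P \<tau> \<chi>s" for \<tau>
    by (simp_all add: exterior_embedding_def interior_embedding_def P_def y)
  have PW: "P \<tau> \<chi>s \<in> W" if "\<tau> \<in> T" for \<tau>
    using that star by (simp add: W_def P)
  have on_E: "(ts \<tau>, rs \<tau>) \<in> E" if "\<tau> \<in> T" for \<tau>
    using nbhd[OF that] that by (force simp: T_def)
  have ext: "r > 0" "A (t, r) > 0" "B (t, r) > 0" if "(t, r) \<in> E" for t r
    using exterior that by (auto simp: vacuum_exterior_def)
  have PE: "P t r \<in> exterior_region E" if "(t, r) \<in> E" for t r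
    using that by (simp add: exterior_region_def P)

  \<comment> \<open>Tangent vectors and the first junction condition\<close>
  have tan_m: "tangent ?Xm 1 (y \<tau>) = vector [1, 0, 0, 0]" "tangent ?Xm 2 (y \<tau>) = vector [0, 0, 1, 0]"
    "tangent ?Xm 3 (y \<tau>) = vector [0, 0, 0, 1]" for \<tau>
    unfolding interior_embedding_eq
    by (rule tangent_exterior_embedding[OF DERIV_ident DERIV_const])+
  have tan_p: "tangent ?Xp 1 (y \<tau>) = vector [deriv ts \<tau>, deriv rs \<tau>, 0, 0]"
    "tangent ?Xp 2 (y \<tau>) = vector [0, 0, 1, 0]" "tangent ?Xp 3 (y \<tau>) = vector [0, 0, 0, 1]"
    if "\<tau> \<in> T" for \<tau>
    using tangent_exterior_embedding[of ts "deriv ts \<tau>" "y \<tau>" rs "deriv rs \<tau>"] ts_D rs_D that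
    by (simp_all add: y)
  have rs_eq: "rs \<tau> = \<chi>s * a \<tau>" if "\<tau> \<in> T" for \<tau>
  proof -
    have "induced_metric ?gp ?Xp 2 2 (y \<tau>) = induced_metric g ?Xm 2 2 (y \<tau>)"
      using J[OF that] unfolding junction_conditions_def by blast
    then have "(rs \<tau>)\<^sup>2 = (\<chi>s * a \<tau>)\<^sup>2"
      by (simp add: induced_metric_def tan_m tan_p[OF that] X P exterior_metric_diag4
          interior_metric_diag4 diag4_mv inner4 vector4_nth power_mult_distrib mult.commute)
    then show ?thesis
      using ext(1)[OF on_E[OF that]] star(2) star(6)[OF that] by (simp add: power2_eq_iff_nonneg)
  qed
  \<comment> \<open>\<tau> is proper time along the surface, also as seen from outside; this is the
    normalisation that \<open>unit_normal_diag4\<close> requires.\<close>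
  have unit: "A (ts \<tau>, rs \<tau>) * (deriv ts \<tau>)\<^sup>2 - B (ts \<tau>, rs \<tau>) * (deriv rs \<tau>)\<^sup>2 = 1" if "\<tau> \<in> T" for \<tau>
  proof -
    have "induced_metric ?gp ?Xp 1 1 (y \<tau>) = induced_metric g ?Xm 1 1 (y \<tau>)"
      using J[OF that] unfolding junction_conditions_def by blast
    then show ?thesis
      by (simp add: induced_metric_def tan_m tan_p[OF that] X P exterior_metric_diag4
          interior_metric_diag4 diag4_mv inner4 vector4_nth power2_eq_square mult_ac)
  qed
  have drs: "deriv rs \<tau> < 0" if "\<tau> \<in> T" for \<tau>
  proof -
    have "((\<lambda>t. \<chi>s * a t) has_real_derivative \<chi>s * deriv a \<tau>) (at \<tau>)"
      by (intro DERIV_cmult a_D that)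
    then have "(rs has_real_derivative \<chi>s * deriv a \<tau>) (at \<tau>)"
      by (rule has_field_derivative_transform_within_open[of _ _ _ T]) (use that rs_eq in \<open>auto simp: T_def\<close>)
    then show ?thesis using star(2) star(7)[OF that] by (simp add: DERIV_imp_deriv mult_pos_neg)
  qed

  \<comment> \<open>Scalar curvature on the two sides and its normal derivative\<close>
  define G where "G \<tau> = 6 * (((a' \<tau>)\<^sup>2 + k) / (a \<tau>)\<^sup>2 + a'' \<tau> / a \<tau>)" for \<tau>
  have RG: "ricci_scalar g z = G (z$1)" if "z \<in> W" for z
    using ricci_scalar_W[OF that] by (simp add: G_def)
  have G_D: "(G has_real_derivative deriv G \<tau>) (at \<tau>)" if "\<tau> \<in> T" for \<tau>
  proof (rule smooth_deriv(2)[OF _ that])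
    have T: "open T" by (simp add: T_def)
    have nz: "a t \<noteq> 0" "(a t)\<^sup>2 \<noteq> 0" if "t \<in> T" for t using a_pos[OF that] by simp_all
    show "smooth T G"
      unfolding G_def divide_inverse
      by (intro smooth_mult smooth_add smooth_const smooth_inverse smooth_power smooth_deriv(1)
          a_smooth nz T)
  qed
  define H where "H t r = ricci_scalar ?gp (P t r)" for t r
  have HG: "H (ts \<tau>) (rs \<tau>) = G \<tau>" if "\<tau> \<in> T" for \<tau>
    using J[OF that] RG[OF PW[OF that]] unfolding junction_conditions_def X H_def by (simp add: P)
  obtain W' where W': "exterior_region E \<subseteq> W'" "smooth W' (ricci_scalar ?gp)"
    using exterior_ricci_scalar_smooth[OF exterior] .
  \<comment> \<open>These are the two-sided partial derivatives that enter
    \<open>normal_derivative\<close>. They exist on the boundary of the exterior by smoothness of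
    the extended metric, but may involve values off \<open>E\<close>.\<close>
  define D where "D \<mu> \<tau> = pd \<mu> (ricci_scalar ?gp) (P (ts \<tau>) (rs \<tau>))" for \<mu> \<tau>
  have D1: "((\<lambda>t. H t (rs \<tau>)) has_real_derivative D 1 \<tau>) (at (ts \<tau>))"
    and D2: "((\<lambda>r. H (ts \<tau>) r) has_real_derivative D 2 \<tau>) (at (rs \<tau>))" if "\<tau> \<in> T" for \<tau>
  proof -
    have "P (ts \<tau>) (rs \<tau>) \<in> W'" using PE[OF on_E[OF that]] W'(1) by blast
    note L = smooth_line(1)[OF W'(2) this, folded D_def]
    have "P (ts \<tau>) (rs \<tau>) + s *\<^sub>R axis 1 1 = P (ts \<tau> + s) (rs \<tau>)"
      "P (ts \<tau>) (rs \<tau>) + s *\<^sub>R axis 2 1 = P (ts \<tau>) (rs \<tau> + s)" for s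
      by (simp_all add: vec_eq_iff forall_4 P_def vector4_nth axis_def)
    then have "((\<lambda>s. H (ts \<tau> + s) (rs \<tau>)) has_real_derivative D 1 \<tau>) (at 0)"
      "((\<lambda>s. H (ts \<tau>) (rs \<tau> + s)) has_real_derivative D 2 \<tau>) (at 0)"
      using L[of 1] L[of 2] by (simp_all add: H_def)
    then show "((\<lambda>t. H t (rs \<tau>)) has_real_derivative D 1 \<tau>) (at (ts \<tau>))"
      "((\<lambda>r. H (ts \<tau>) r) has_real_derivative D 2 \<tau>) (at (rs \<tau>))"
      using DERIV_shift[of "\<lambda>t. H t (rs \<tau>)" "D 1 \<tau>" 0 "ts \<tau>"] DERIV_shift[of "H (ts \<tau>)" "D 2 \<tau>" 0 "rs \<tau>"]
      by (simp_all add: add.commute)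
  qed
  have normal: "\<exists>n1 n2. n1 < 0 \<and> n2 > 0 \<and> n1 * D 1 \<tau> + n2 * D 2 \<tau> = 0" if "\<tau> \<in> T" for \<tau>
  proof -
    let ?A = "A (ts \<tau>, rs \<tau>)" and ?B = "B (ts \<tau>, rs \<tau>)"
    note e = ext[OF on_E[OF that]]
    have Np: "unit_normal ?gp ?Xp (y \<tau>) = vector [sqrt (?B / ?A) * deriv rs \<tau>, sqrt (?A / ?B) * deriv ts \<tau>, 0, 0]"
      by (rule unit_normal_diag4[OF _ tan_p[OF that] e(2,3) _ _ ts_pos[OF that] unit[OF that]])
        (use e(1) in \<open>auto simp: X exterior_metric_diag4 P\<close>)
    \<comment> \<open>The surface is at rest in comoving coordinates, so the interior normal is
      purely radial; it is paired with the radial derivative of R^-, which is zero.\<close>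
    have Nm: "\<exists>c. unit_normal g ?Xm (y \<tau>) = vector [0, c, 0, 0]"
    proof -
      have "unit_normal g ?Xm (y \<tau>) = vector [sqrt (((a \<tau>)\<^sup>2 / (1 - k * \<chi>s\<^sup>2)) / 1) * 0,
          sqrt (1 / ((a \<tau>)\<^sup>2 / (1 - k * \<chi>s\<^sup>2))) * 1, 0, 0]"
        by (rule unit_normal_diag4[OF _ tan_m]) (use star(2,3) star(6)[OF that] in
            \<open>auto simp: X P interior_metric_diag4 intro!: divide_pos_pos\<close>)
      then show ?thesis by auto
    qed
    have "pd 2 (ricci_scalar g) (P \<tau> \<chi>s) = 0"
      using pd_cong_open[OF open_W PW[OF that], of "ricci_scalar g" "\<lambda>z. G (z$1)" 2]
        pd_component[OF _, of G "deriv G \<tau>" "P \<tau> \<chi>s" 1 2] G_D[OF that]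
      by (simp add: RG P axis_def)
    then have "normal_derivative g ?Xm (ricci_scalar g) (y \<tau>) = 0"
      using Nm by (auto simp: normal_derivative_def sum_4 X vector4_nth)
    then have "normal_derivative ?gp ?Xp (ricci_scalar ?gp) (y \<tau>) = 0"
      using J[OF that] by (simp add: junction_conditions_def)
    then have "sqrt (?B / ?A) * deriv rs \<tau> * D 1 \<tau> + sqrt (?A / ?B) * deriv ts \<tau> * D 2 \<tau> = 0"
      by (simp add: normal_derivative_def sum_4 X Np vector4_nth D_def)
    moreover have "sqrt (?B / ?A) * deriv rs \<tau> < 0" "sqrt (?A / ?B) * deriv ts \<tau> > 0"
      using e(2,3) drs[OF that] ts_pos[OF that] by (simp_all add: mult_pos_neg)
    ultimately show ?thesis by blast
  qed

  \<comment> \<open>Curves that leave the surface into the exterior\<close>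
  have later: "\<forall>\<^sub>F u in at_right \<tau>. u \<in> T \<and> (ts u, rs \<tau>) \<in> E"
    and earlier: "\<forall>\<^sub>F u in at_left \<tau>. u \<in> T \<and> (ts \<tau>, rs u) \<in> E"
    and outside: "\<forall>\<^sub>F r in at_right (rs \<tau>). (ts \<tau>, r) \<in> E" if \<tau>: "\<tau> \<in> T" for \<tau>
  proof -
    obtain \<epsilon> where \<epsilon>: "\<epsilon> > 0" "\<And>u r. u \<in> T \<Longrightarrow> \<bar>u - \<tau>\<bar> < \<epsilon> \<Longrightarrow> rs u \<le> r \<Longrightarrow> r < rs u + \<epsilon> \<Longrightarrow> (ts u, r) \<in> E"
      using nbhd[OF \<tau>] by (force simp: T_def)
    have T_ev: "\<forall>\<^sub>F u in at \<tau> within S. u \<in> T" for S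
      unfolding eventually_at_topological by (rule exI[of _ T]) (use \<tau> in \<open>auto simp: T_def\<close>)
    have near: "\<forall>\<^sub>F u in at \<tau> within S. \<bar>u - \<tau>\<bar> < \<epsilon>" for S
      using \<epsilon>(1) by (auto simp: eventually_at dist_real_def)
    have "isCont rs \<tau>" using rs_D[OF \<tau>] by (rule DERIV_isCont)
    then have lim: "(rs \<longlongrightarrow> rs \<tau>) (at \<tau> within S)" for S
      using continuous_at_imp_continuous_at_within continuous_within by blast
    have cont: "\<forall>\<^sub>F u in at \<tau> within S. \<bar>rs u - rs \<tau>\<bar> < \<epsilon>" for S
      using tendstoD[OF lim \<epsilon>(1)] by (simp add: dist_real_def)
    have mono: "rs v < rs u" if "u \<in> T" "v \<in> T" "u < v" for u v
      using a_decreasing[OF that] star(2) by (simp add: rs_eq that)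
    have "\<forall>\<^sub>F u in at_right \<tau>. u > \<tau>" by (simp add: eventually_at_filter)
    \<comment> \<open>Collapse puts the surface at the later time \<open>u\<close> below the old
      radius \<open>rs \<tau>\<close>, and continuity keeps it within \<epsilon>, so the one-sided
      neighbourhood reaches that radius.\<close>
    with T_ev near cont show "\<forall>\<^sub>F u in at_right \<tau>. u \<in> T \<and> (ts u, rs \<tau>) \<in> E"
    proof eventually_elim
      case (elim u)
      then show ?case using \<epsilon>(2)[of u "rs \<tau>"] mono[of \<tau> u] \<tau> by auto
    qed
    have "\<forall>\<^sub>F u in at_left \<tau>. u < \<tau>" by (simp add: eventually_at_filter)
    \<comment> \<open>Dually, an earlier radius \<open>rs u\<close> lies above the surface at time
      \<tau> by less than \<epsilon>.\<close>
    with T_ev cont show "\<forall>\<^sub>F u in at_left \<tau>. u \<in> T \<and> (ts \<tau>, rs u) \<in> E"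
    proof eventually_elim
      case (elim u)
      then show ?case using \<epsilon>(2)[of \<tau> "rs u"] mono[of u \<tau>] \<tau> \<epsilon>(1) by auto
    qed
    show "\<forall>\<^sub>F r in at_right (rs \<tau>). (ts \<tau>, r) \<in> E"
      unfolding eventually_at_right_field
      by (rule exI[of _ "rs \<tau> + \<epsilon>"]) (use \<epsilon> \<tau> in auto)
  qed

  \<comment> \<open>Both curves are parametrised by the interior time \<open>u\<close>, which makes
    them comparable with \<open>G\<close>.\<close>
  have along_t: "((\<lambda>u. H (ts u) (rs \<tau>)) has_real_derivative D 1 \<tau> * deriv ts \<tau>) (at \<tau>)"
    and along_r: "((\<lambda>u. H (ts \<tau>) (rs u)) has_real_derivative D 2 \<tau> * deriv rs \<tau>) (at \<tau>)" if "\<tau> \<in> T" for \<tau>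
    using DERIV_chain2[OF D1[OF that] ts_D[OF that]] DERIV_chain2[OF D2[OF that] rs_D[OF that]] by auto

  \<comment> \<open>Constancy of the interior curvature\<close>
  have dG: "deriv G \<tau> = 0" if \<tau>: "\<tau> \<in> T" for \<tau>
    using R_of_t_or_r
  proof (elim disjE exE)
    fix F :: "real \<Rightarrow> real"
    assume "\<forall>x\<in>exterior_region E. ricci_scalar ?gp x = F (x$1)"
    then have F: "H t r = F t" if "(t, r) \<in> E" for t r
      using PE[OF that] by (simp add: H_def P)
    \<comment> \<open>At fixed time, moving outward stays in \<open>E\<close>, and there R^+ is
      constant.\<close>
    have "\<forall>\<^sub>F r in at_right (rs \<tau>). H (ts \<tau>) r = F (ts \<tau>)"
      using outside[OF \<tau>] by eventually_elim (rule F)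
    then have "D 2 \<tau> = 0"
      using has_real_derivative_unique_one_sided[OF D2[OF \<tau>] DERIV_const] F[OF on_E[OF \<tau>]] by simp
    then have "D 1 \<tau> = 0" using normal[OF \<tau>] by auto
    \<comment> \<open>The point (\<open>ts u\<close>, \<open>rs \<tau>\<close>) has the same time as
      the surface point of \<open>u\<close>, hence the same curvature, which is \<open>G u\<close>
      by the third junction condition.\<close>
    moreover have "\<forall>\<^sub>F u in at_right \<tau>. H (ts u) (rs \<tau>) = G u"
      using later[OF \<tau>]
    proof eventually_elim
      case (elim u)
      then show ?case using F[of "ts u" "rs \<tau>"] F[OF on_E, of u] HG[of u] by simp
    qed
    ultimately show ?thesis
      using has_real_derivative_unique_one_sided[OF along_t[OF \<tau>] G_D[OF \<tau>] HG[OF \<tau>]] by simp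
  next
    fix F :: "real \<Rightarrow> real"
    assume "\<forall>x\<in>exterior_region E. ricci_scalar ?gp x = F (x$2)"
    then have F: "H t r = F r" if "(t, r) \<in> E" for t r
      using PE[OF that] by (simp add: H_def P)
    \<comment> \<open>At fixed radius only later times are known to lie in \<open>E\<close>, because
      the surface recedes inward.\<close>
    have "\<forall>\<^sub>F u in at_right \<tau>. H (ts u) (rs \<tau>) = F (rs \<tau>)"
      using later[OF \<tau>] by eventually_elim (simp add: F)
    then have "D 1 \<tau> * deriv ts \<tau> = 0"
      using has_real_derivative_unique_one_sided[OF along_t[OF \<tau>] DERIV_const] F[OF on_E[OF \<tau>]] by simp
    then have "D 1 \<tau> = 0" using ts_pos[OF \<tau>] by simp
    then have "D 2 \<tau> = 0" using normal[OF \<tau>] by auto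
    \<comment> \<open>The point (\<open>ts \<tau>\<close>, \<open>rs u\<close>) shares its radius
      with the surface point of \<open>u\<close>; for it to lie outside the star, \<open>u\<close>
      must precede \<tau>.\<close>
    moreover have "\<forall>\<^sub>F u in at_left \<tau>. H (ts \<tau>) (rs u) = G u"
      using earlier[OF \<tau>]
    proof eventually_elim
      case (elim u)
      then show ?case using F[of "ts \<tau>" "rs u"] F[OF on_E, of u] HG[of u] by simp
    qed
    ultimately show ?thesis
      using has_real_derivative_unique_one_sided[OF along_r[OF \<tau>] G_D[OF \<tau>] HG[OF \<tau>]] by simp
  qed

  \<comment> \<open>Contradiction with the growing dust density\<close>
  have "\<exists>c. \<forall>\<tau>\<in>T. G \<tau> = c"
  proof (rule has_field_derivative_zero_constant)
    show "convex T" by (simp add: T_def)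
    show "(G has_real_derivative 0) (at \<tau> within T)" if "\<tau> \<in> T" for \<tau>
      using G_D[OF that] dG[OF that] by (simp add: has_field_derivative_at_within)
  qed
  then obtain c where c: "G \<tau> = c" if "\<tau> \<in> T" for \<tau> by blast
  have Rc: "ricci_scalar g z = c" if "z \<in> W" for z
    using RG[OF that] c that by (simp add: W_def)
  have trace: "deriv f c * c - 2 * f c = - \<kappa> * (\<rho>0 / (a \<tau>)^3)" if "\<tau> \<in> T" for \<tau>
  proof -
    have "P \<tau> \<chi>s \<in> interior_region \<tau>c \<chi>s"
      using that star(2) by (simp add: interior_region_def P T_def)
    from field_eqs_trace[OF PW[OF that] Rc eqs[OF this]] show ?thesis by (simp add: P)
  qed
  \<comment> \<open>Any two distinct times in \<open>T\<close> would do: the trace equation forces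
    equal densities, whereas \<open>a\<close> is strictly decreasing.\<close>
  have m: "\<tau>c / 3 \<in> T" "\<tau>c / 2 \<in> T" using star(4) by (simp_all add: T_def)
  have "\<kappa> * (\<rho>0 / a (\<tau>c / 2) ^ 3) = \<kappa> * (\<rho>0 / a (\<tau>c / 3) ^ 3)"
    using trace[OF m(1)] trace[OF m(2)] by simp
  then have "a (\<tau>c / 2) ^ 3 = a (\<tau>c / 3) ^ 3"
    using star(1) star(6)[OF m(1)] star(6)[OF m(2)] \<open>\<kappa> > 0\<close> by (simp add: frac_eq_eq)
  moreover have "a (\<tau>c / 2) < a (\<tau>c / 3)"
    using a_decreasing[OF m] star(4) by simp
  ultimately show False
    using power_strict_mono[of "a (\<tau>c / 2)" "a (\<tau>c / 3)" 3] star(6)[OF m(2)] by simp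
qed

end
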